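(* $E^{ce}_3\equiv_cZ^{ce}_0$, i.e. $E^{ce}_3\leq_cZ^{ce}_0$ and $Z^{ce}_0\leq_cE^{ce}_3$.
   Context: $W_e$ is the $e$-th c.e. set; $A^{[n]}=\{x:\langle x,n\rangle\in A\}$ is the $n$-th column of $A\subseteq\omega$. $i\,E^{ce}_3\,j\iff$ for every $n$, $W_i^{[n]}\triangle W_j^{[n]}$ is finite. $i\,Z^{ce}_0\,j\iff\lim_{n\to\infty}\frac{|(W_i\triangle W_j)\cap\{0,\dots,n-1\}|}{n}=0$. $E\leq_cF$ means there is a total computable $g$ with $x\,E\,y\iff g(x)\,F\,g(y)$ for all $x,y$. *)

theory Defs
  imports Complex_Main "HOL-Library.Nat_Bijection"
begin

datatype recf =
    Zero
  | Succ
  | Proj nat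
  | Comp recf "recf list"
  | Prec recf recf
  | Mini recf

text \<open>Evaluation relation: eval f xs v means the partial recursive function f,
  applied to the argument list xs, converges with value v.  Missing arguments
  are read as 0 (arity-free variant of Kleene's schemes).\<close>

definition arg :: "nat list \<Rightarrow> nat \<Rightarrow> nat" where
  "arg xs i = (if i < length xs then xs ! i else 0)"

inductive eval :: "recf \<Rightarrow> nat list \<Rightarrow> nat \<Rightarrow> bool" where
  eval_Zero: "eval Zero xs 0"
| eval_Succ: "eval Succ xs (Suc (arg xs 0))"
| eval_Proj: "eval (Proj i) xs (arg xs i)"
| eval_Comp: "list_all2 (\<lambda>g y. eval g xs y) gs ys \<Longrightarrow> eval f ys v \<Longrightarrow> eval (Comp f gs) xs v"
| eval_Prec0: "eval f xs v \<Longrightarrow> eval (Prec f g) (0 # xs) v"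
| eval_PrecS: "eval (Prec f g) (n # xs) u \<Longrightarrow> eval g (u # n # xs) v \<Longrightarrow> eval (Prec f g) (Suc n # xs) v"
| eval_Mini: "eval f (n # xs) 0 \<Longrightarrow> (\<forall>m<n. \<exists>v. eval f (m # xs) v \<and> 0 < v) \<Longrightarrow> eval (Mini f) xs n"

primrec encode :: "recf \<Rightarrow> nat" where
  "encode Zero = prod_encode (0, 0)"
| "encode Succ = prod_encode (1, 0)"
| "encode (Proj i) = prod_encode (2, i)"
| "encode (Comp f gs) = prod_encode (3, prod_encode (encode f, list_encode (map encode gs)))"
| "encode (Prec f g) = prod_encode (4, prod_encode (encode f, encode g))"
| "encode (Mini f) = prod_encode (5, encode f)"

definition phi :: "nat \<Rightarrow> recf" where
  "phi e = (if \<exists>r. encode r = e then (SOME r. encode r = e) else Zero)"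

definition W :: "nat \<Rightarrow> nat set" where
  "W e = {x. \<exists>v. eval (phi e) [x] v}"

definition computable :: "(nat \<Rightarrow> nat) \<Rightarrow> bool" where
  "computable g \<longleftrightarrow> (\<exists>r. \<forall>x. eval r [x] (g x))"

definition column :: "nat set \<Rightarrow> nat \<Rightarrow> nat set" where
  "column A n = {x. prod_encode (x, n) \<in> A}"

definition symdiff :: "nat set \<Rightarrow> nat set \<Rightarrow> nat set" where
  "symdiff A B = (A - B) \<union> (B - A)"

definition E3ce :: "nat \<Rightarrow> nat \<Rightarrow> bool" where
  "E3ce i j \<longleftrightarrow> (\<forall>n. finite (symdiff (column (W i) n) (column (W j) n)))"

definition Z0ce :: "nat \<Rightarrow> nat \<Rightarrow> bool" where
  "Z0ce i j \<longleftrightarrow>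
     (\<lambda>n. real (card (symdiff (W i) (W j) \<inter> {0..<n})) / real n) \<longlonglongrightarrow> 0"

definition creducible :: "(nat \<Rightarrow> nat \<Rightarrow> bool) \<Rightarrow> (nat \<Rightarrow> nat \<Rightarrow> bool) \<Rightarrow> bool" where
  "creducible E F \<longleftrightarrow> (\<exists>g. computable g \<and> (\<forall>x y. E x y \<longleftrightarrow> F (g x) (g y)))"

end

theory Submission
  imports Defs "HOL-Library.Transitive_Closure_Table"
begin

text \<open>
  For \<open>E3 \<le> Z0\<close>, let the element \<open>x\<close> of column \<open>n\<close> control all numbers in \<open>[2^x, 2^(x+1))\<close> of
  2-adic valuation \<open>n\<close>.  Infinitely many differences in column \<open>n\<close> give upper density at least
  \<open>2^-(n+2)\<close>, whereas if every column has only finitely many differences, then almost all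
  differences are divisible by any given power of 2.

  For \<open>Z0 \<le> E3\<close>, write \<open>d\<close> for the upper density of the symmetric difference and join \<open>a\<close> to \<open>b\<close> at
  scale \<open>k\<close> if \<open>d(a,b)\<close> is at most \<open>2^-(k+a+b+2)\<close>.  The weights along a path without repeated
  vertices sum to at most \<open>2^-k\<close>, so \<open>Z0\<close> is the intersection over \<open>k\<close> of the equivalence relations
  generated by these edges.  That a pair is an edge with threshold \<open>N\<close> is a \<open>\<Pi>2\<close> condition, i.e.
  a computable-from-below length of agreement is infinite.  At scale \<open>k\<close>, put into play finite
  lists that guess, for each potential edge \<open>w\<close> below the length of the list, the exact final
  length of agreement or infinity, together with a set of vertices respecting the edges guessed
  to be infinite.  A list enters the \<open>k\<close>-th column of \<open>u\<close> when its finite guesses have been reached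
  and either \<open>u\<close> is in its vertex set or some finite guess has been exceeded.  Lists with a wrong
  finite guess thus never tell two columns apart, a true edge makes the two columns differ on
  finitely many lists only, and correct guesses with the component of \<open>i\<close> as vertex set
  separate \<open>i\<close> from every \<open>j\<close> outside this component.
\<close>

section \<open>Computable functions and decidable predicates\<close>

inductive_cases eval_ZeroE: "eval Zero xs v"
inductive_cases eval_SuccE: "eval Succ xs v"
inductive_cases eval_ProjE: "eval (Proj i) xs v"
inductive_cases eval_CompE: "eval (Comp f gs) xs v"
inductive_cases eval_Prec0E: "eval (Prec f g) (0 # xs) v"
inductive_cases eval_PrecSE: "eval (Prec f g) (Suc n # xs) v"
inductive_cases eval_MiniE: "eval (Mini f) xs v"

lemma eval_deterministic: "eval f xs v \<Longrightarrow> eval f xs v' \<Longrightarrow> v = v'"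
proof (induction arbitrary: v' rule: eval.induct)
  case (eval_Comp xs gs ys f v)
  from eval_Comp.prems obtain ys' where ys': "list_all2 (\<lambda>g y. eval g xs y) gs ys'" "eval f ys' v'"
    by (rule eval_CompE)
  have "ys' = ys"
    using eval_Comp.IH(1) ys'(1)
  proof (induction arbitrary: ys' rule: list_all2_induct)
    case (Cons g gs y ys)
    then show ?case by (cases ys') auto
  qed simp
  then show ?case using eval_Comp.IH(2) ys'(2) by simp
next
  case (eval_PrecS f g n xs u v)
  from eval_PrecS.prems obtain u' where "eval (Prec f g) (n # xs) u'" "eval g (u' # n # xs) v'"
    by (rule eval_PrecSE)
  then show ?case using eval_PrecS.IH by blast
next
  case (eval_Mini f n xs)
  from eval_Mini.prems obtain w where w: "v' = w" "eval f (w # xs) 0"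
      "\<forall>m<w. \<exists>v. eval f (m # xs) v \<and> 0 < v"
    by (auto elim!: eval_MiniE)
  have "\<not> n < w"
  proof
    assume "n < w"
    then obtain v where "eval f (n # xs) v" "0 < v" using w(3) by blast
    then show False using eval_Mini.IH(1) by blast
  qed
  moreover have "\<not> w < n"
  proof
    assume "w < n"
    then obtain v where "\<forall>v'. eval f (w # xs) v' \<longrightarrow> v = v'" "0 < v"
      using eval_Mini.IH(2) by blast
    then show False using w(2) by blast
  qed
  ultimately show ?case using w(1) by simp
next
  case (eval_Prec0 f xs v g)
  from eval_Prec0.prems have "eval f xs v'" by (rule eval_Prec0E)
  then show ?case by (rule eval_Prec0.IH)
qed (blast elim: eval_ZeroE eval_SuccE eval_ProjE)+

text \<open>
  Computability with respect to the argument list.  Once pairing is available, everything is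
  expressed with unary \<^const>\<open>computable\<close> functions of a coded environment.
\<close>

definition rc :: "(nat list \<Rightarrow> nat) \<Rightarrow> bool" where
  "rc F \<longleftrightarrow> (\<exists>r. \<forall>xs. eval r xs (F xs))"

lemma arg_Cons [simp]: "arg (x # xs) 0 = x" "arg (x # xs) (Suc i) = arg xs i"
  by (simp_all add: arg_def)

lemma rc_arg: "rc (\<lambda>xs. arg xs i)"
  unfolding rc_def by (meson eval_Proj)

lemma rc_comp:
  assumes "rc F" "list_all rc Gs"
  shows "rc (\<lambda>xs. F (map (\<lambda>G. G xs) Gs))"
proof -
  obtain f where f: "\<And>xs. eval f xs (F xs)" using assms(1) by (auto simp: rc_def)
  have "\<forall>G. \<exists>r. rc G \<longrightarrow> (\<forall>xs. eval r xs (G xs))" by (auto simp: rc_def)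
  then obtain R where R: "\<And>G xs. rc G \<Longrightarrow> eval (R G) xs (G xs)" by metis
  have "eval (Comp f (map R Gs)) xs (F (map (\<lambda>G. G xs) Gs))" for xs
    using assms(2) R f
    by (intro eval_Comp[where ys = "map (\<lambda>G. G xs) Gs"])
       (auto simp: list_all2_conv_all_nth list_all_length)
  then show ?thesis by (auto simp: rc_def)
qed

lemma rc_comp1: "rc F \<Longrightarrow> rc A \<Longrightarrow> rc (\<lambda>xs. F [A xs])"
  using rc_comp[of F "[A]"] by simp

lemma rc_zero: "rc (\<lambda>xs. 0)"
  unfolding rc_def by (meson eval_Zero)

lemma rc_Suc: "rc A \<Longrightarrow> rc (\<lambda>xs. Suc (A xs))"
proof -
  have "rc (\<lambda>xs. Suc (arg xs 0))" unfolding rc_def by (meson eval_Succ)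
  then show "rc A \<Longrightarrow> rc (\<lambda>xs. Suc (A xs))" by (drule_tac rc_comp1) auto
qed

lemma rc_const: "rc (\<lambda>xs. c)"
  by (induction c) (auto intro: rc_zero rc_Suc)

lemma rc_rec:
  assumes "rc F" "rc G" "rc A" "rc N"
  shows "rc (\<lambda>xs. rec_nat (F [A xs]) (\<lambda>n u. G [u, n, A xs]) (N xs))"
proof -
  obtain f g where f: "\<And>xs. eval f xs (F xs)" and g: "\<And>xs. eval g xs (G xs)"
    using assms(1,2) by (auto simp: rc_def)
  obtain a m where a: "\<And>xs. eval a xs (A xs)" and m: "\<And>xs. eval m xs (N xs)"
    using assms(3,4) by (auto simp: rc_def)
  have p: "eval (Prec f g) [k, c] (rec_nat (F [c]) (\<lambda>n u. G [u, n, c]) k)" for k c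
    by (induction k) (auto intro: f g eval.intros)
  have "eval (Comp (Prec f g) [m, a]) xs (rec_nat (F [A xs]) (\<lambda>n u. G [u, n, A xs]) (N xs))" for xs
    by (rule eval_Comp[where ys = "[N xs, A xs]"]) (auto intro: a m p)
  then show ?thesis by (auto simp: rc_def)
qed

lemma rc_add: assumes "rc A" "rc B" shows "rc (\<lambda>xs. A xs + B xs)"
proof -
  have "rec_nat a (\<lambda>n u. Suc u) b = a + b" for a b by (induction b) auto
  then show ?thesis
    using rc_rec[OF rc_arg[of 0] rc_Suc[OF rc_arg[of 0]] assms] by simp
qed

lemma rc_mult: assumes "rc A" "rc B" shows "rc (\<lambda>xs. A xs * B xs)"
proof -
  have "rec_nat 0 (\<lambda>n u. u + a) b = a * b" for a b :: nat by (induction b) auto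
  then show ?thesis
    using rc_rec[OF rc_zero rc_add[OF rc_arg[of 0] rc_arg[of "Suc (Suc 0)"]] assms] by simp
qed

lemma rc_diff: assumes "rc A" "rc B" shows "rc (\<lambda>xs. A xs - B xs)"
proof -
  have p: "rec_nat 0 (\<lambda>n u. n) b = b - Suc 0" for b :: nat by (cases b) auto
  have *: "rc C \<Longrightarrow> rc (\<lambda>xs. C xs - Suc 0)" for C
    using rc_rec[OF rc_zero rc_arg[of "Suc 0"] rc_zero, of C] by (simp add: p)
  have "rec_nat a (\<lambda>n u. u - Suc 0) b = a - b" for a b :: nat by (induction b) auto
  then show ?thesis
    using rc_rec[OF rc_arg[of 0] *[OF rc_arg[of 0]] assms] by simp
qed

lemma rc_triangle: assumes "rc A" shows "rc (\<lambda>xs. triangle (A xs))"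
proof -
  have "rec_nat 0 (\<lambda>n u. u + Suc n) b = triangle b" for b by (induction b) auto
  then show ?thesis
    using rc_rec[OF rc_zero rc_add[OF rc_arg[of 0] rc_Suc[OF rc_arg[of "Suc 0"]]] rc_zero assms]
    by simp
qed

lemma rc_prod_encode: "rc A \<Longrightarrow> rc B \<Longrightarrow> rc (\<lambda>xs. prod_encode (A xs, B xs))"
  unfolding prod_encode_def by (simp add: rc_add rc_triangle)

text \<open>The index of the Cantor diagonal containing \<open>z\<close>, written with truncated subtraction only.\<close>

primrec diag :: "nat \<Rightarrow> nat" where
  "diag 0 = 0"
| "diag (Suc n) = diag n + (1 - (triangle (Suc (diag n)) - Suc n))"

lemma diag_bounds: "triangle (diag z) \<le> z \<and> z < triangle (Suc (diag z))"
proof (induction z)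
  case (Suc z)
  then show ?case
    \<comment> \<open>The condition fails exactly when \<open>z\<close> is the last number of its
      diagonal, and then the index goes up by one.\<close>
    by (cases "z < triangle (diag z) + diag z") (auto simp: le_Suc_eq not_less)
qed simp

lemma diag_prod_encode: "diag (prod_encode (a, b)) = a + b"
proof -
  have mono: "triangle m \<le> triangle n" if "m \<le> n" for m n
    using that by (induction n rule: dec_induct) auto
  let ?z = "prod_encode (a, b)"
  have z: "triangle (a + b) \<le> ?z" "?z < triangle (Suc (a + b))" by (auto simp: prod_encode_def)
  have "\<not> Suc (diag ?z) \<le> a + b" using mono diag_bounds[of ?z] z by (meson leD order.strict_trans2)
  moreover have "\<not> Suc (a + b) \<le> diag ?z" using mono diag_bounds[of ?z] z by (meson leD order.strict_trans2)
  ultimately show ?thesis by linarith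
qed

lemma prod_decode_diag: "prod_decode z = (z - triangle (diag z), diag z - (z - triangle (diag z)))"
proof -
  obtain a b where "z = prod_encode (a, b)" by (metis prod_decode_inverse surj_pair)
  then show ?thesis by (simp add: diag_prod_encode) (simp add: prod_encode_def)
qed

lemma rc_diag: assumes "rc A" shows "rc (\<lambda>xs. diag (A xs))"
proof -
  let ?G = "\<lambda>ys. arg ys 0 + (1 - (triangle (Suc (arg ys 0)) - Suc (arg ys (Suc 0))))"
  have G: "rc ?G"
    by (intro rc_add rc_diff rc_const rc_triangle rc_Suc rc_arg)
  have "rec_nat 0 (\<lambda>n u. ?G [u, n, 0]) b = diag b" for b by (induction b) auto
  then show ?thesis
    using rc_rec[OF rc_zero G rc_zero assms] by simp
qed

abbreviation p1 :: "nat \<Rightarrow> nat" where "p1 z \<equiv> fst (prod_decode z)"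
abbreviation p2 :: "nat \<Rightarrow> nat" where "p2 z \<equiv> snd (prod_decode z)"

lemma rc_p1: "rc A \<Longrightarrow> rc (\<lambda>xs. p1 (A xs))"
  and rc_p2: "rc A \<Longrightarrow> rc (\<lambda>xs. p2 (A xs))"
  unfolding prod_decode_diag by (simp_all add: rc_diff rc_triangle rc_diag)

lemma rc_imp_computable: "rc F \<Longrightarrow> computable (\<lambda>x. F [x])"
  unfolding rc_def computable_def by blast

lemma computable_imp_rc:
  assumes "computable f" "rc A" shows "rc (\<lambda>xs. f (A xs))"
proof -
  obtain r a where "\<And>x. eval r [x] (f x)" "\<And>xs. eval a xs (A xs)"
    using assms unfolding rc_def computable_def by blast
  then have "eval (Comp r [a]) xs (f (A xs))" for xs
    by (intro eval_Comp[where ys = "[A xs]"]) auto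
  then show ?thesis by (auto simp: rc_def)
qed

lemma computable_rc_iff: "computable f \<longleftrightarrow> rc (\<lambda>xs. f (arg xs 0))"
  using computable_imp_rc[OF _ rc_arg] rc_imp_computable[of "\<lambda>xs. f (arg xs 0)"] by auto

section \<open>Closure properties of unary computable functions and decidable predicates\<close>

named_theorems computable_intros

lemma computable_basic [computable_intros]:
  "computable (\<lambda>x. x)"
  "computable (\<lambda>x. c)"
  "computable A \<Longrightarrow> computable (\<lambda>x. Suc (A x))"
  "computable A \<Longrightarrow> computable (\<lambda>x. p1 (A x))"
  "computable A \<Longrightarrow> computable (\<lambda>x. p2 (A x))"
  "computable A \<Longrightarrow> computable B \<Longrightarrow> computable (\<lambda>x. A x + B x)"
  "computable A \<Longrightarrow> computable B \<Longrightarrow> computable (\<lambda>x. A x * B x)"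
  "computable A \<Longrightarrow> computable B \<Longrightarrow> computable (\<lambda>x. A x - B x)"
  "computable A \<Longrightarrow> computable B \<Longrightarrow> computable (\<lambda>x. prod_encode (A x, B x))"
  unfolding computable_rc_iff
  by (auto intro: rc_arg rc_const rc_Suc rc_p1 rc_p2 rc_add rc_mult rc_diff rc_prod_encode)

lemma computable_compose: "computable f \<Longrightarrow> computable A \<Longrightarrow> computable (\<lambda>x. f (A x))"
  unfolding computable_rc_iff[of A] computable_rc_iff[of "\<lambda>x. f (A x)"] by (rule computable_imp_rc)

text \<open>The step function is tested on one number \<open>z\<close> coding environment, counter
  and previous value, so terms under the recursion are again treated as unary functions.\<close>

lemma computable_rec [computable_intros]:
  assumes "computable A" "computable (\<lambda>z. G (p1 z) (p1 (p2 z)) (p2 (p2 z)))" "computable N"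
  shows "computable (\<lambda>x. rec_nat (A x) (\<lambda>n u. G x n u) (N x))"
proof -
  let ?G = "\<lambda>ys. G (arg ys 2) (arg ys 1) (arg ys 0)"
  have "rc (\<lambda>ys. (\<lambda>z. G (p1 z) (p1 (p2 z)) (p2 (p2 z)))
        (prod_encode (arg ys 2, prod_encode (arg ys 1, arg ys 0))))"
    by (intro computable_imp_rc[OF assms(2)] rc_prod_encode rc_arg)
  then have G: "rc ?G" by simp
  show ?thesis
    using rc_imp_computable[OF rc_rec[OF computable_imp_rc[OF assms(1) rc_arg[of 0]] G rc_arg[of 0]
            computable_imp_rc[OF assms(3) rc_arg[of 0]]]]
    by (simp add: numeral_2_eq_2)
qed

lemma computable_power [computable_intros]:
  assumes "computable A" "computable B" shows "computable (\<lambda>x. A x ^ B x)"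
proof -
  have "rec_nat 1 (\<lambda>n u. u * a) b = a ^ b" for a b :: nat by (induction b) auto
  moreover have "computable (\<lambda>x. rec_nat 1 (\<lambda>n u. u * A x) (B x))"
    by (intro computable_intros assms assms[THEN computable_compose])
  ultimately show ?thesis by simp
qed

definition dec :: "(nat \<Rightarrow> bool) \<Rightarrow> bool" where
  "dec P \<longleftrightarrow> computable (\<lambda>x. of_bool (P x))"

lemma dec_not [computable_intros]: "dec P \<Longrightarrow> dec (\<lambda>x. \<not> P x)"
proof -
  assume "dec P"
  then have "computable (\<lambda>x. 1 - of_bool (P x))"
    unfolding dec_def by (intro computable_intros)
  moreover have "(1 - of_bool (P x) :: nat) = of_bool (\<not> P x)" for x by simp
  ultimately show ?thesis by (simp add: dec_def)
qed

lemma dec_conj [computable_intros]: "dec P \<Longrightarrow> dec Q \<Longrightarrow> dec (\<lambda>x. P x \<and> Q x)"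
  unfolding dec_def of_bool_conj by (intro computable_intros)

lemma dec_disj [computable_intros]: "dec P \<Longrightarrow> dec Q \<Longrightarrow> dec (\<lambda>x. P x \<or> Q x)"
  using dec_not[OF dec_conj[OF dec_not dec_not]] by simp

lemma dec_imp [computable_intros]: "dec P \<Longrightarrow> dec Q \<Longrightarrow> dec (\<lambda>x. P x \<longrightarrow> Q x)"
  unfolding imp_conv_disj by (intro computable_intros)

lemma dec_le [computable_intros]:
  assumes "computable A" "computable B" shows "dec (\<lambda>x. A x \<le> B x)"
proof -
  have "computable (\<lambda>x. 1 - (A x - B x))" by (intro computable_intros assms)
  moreover have "(1 - (a - b) :: nat) = of_bool (a \<le> b)" for a b by auto
  ultimately show ?thesis by (simp add: dec_def)
qed

lemma dec_less [computable_intros]: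
  "computable A \<Longrightarrow> computable B \<Longrightarrow> dec (\<lambda>x. A x < B x)"
  unfolding less_eq_Suc_le by (intro computable_intros)

lemma dec_eq [computable_intros]:
  "computable A \<Longrightarrow> computable B \<Longrightarrow> dec (\<lambda>x. A x = B x)"
  unfolding eq_iff by (intro computable_intros)

lemma dec_iff [computable_intros]: "dec P \<Longrightarrow> dec Q \<Longrightarrow> dec (\<lambda>x. P x = Q x)"
  using dec_conj[OF dec_imp[of P Q] dec_imp[of Q P]] by (simp add: iff_conv_conj_imp)

lemma computable_if [computable_intros]:
  assumes "dec P" "computable A" "computable B" shows "computable (\<lambda>x. if P x then A x else B x)"
proof -
  have "computable (\<lambda>x. of_bool (P x) * A x + (1 - of_bool (P x)) * B x)"
    using assms unfolding dec_def by (intro computable_intros)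
  moreover have "of_bool p * a + (1 - of_bool p) * b = (if p then a else b)" for p and a b :: nat
    by auto
  ultimately show ?thesis by simp
qed

lemma dec_all [computable_intros]:
  assumes "computable N" "dec (\<lambda>z. P (p1 z) (p2 z))"
  shows "dec (\<lambda>x. \<forall>y<N x. P x y)"
proof -
  have *: "computable (\<lambda>z. of_bool (P (p1 z) (p1 (p2 z))))"
    using computable_compose[OF assms(2)[unfolded dec_def], of "\<lambda>z. prod_encode (p1 z, p1 (p2 z))"]
    by (simp add: computable_basic)
  have "computable (\<lambda>x. rec_nat 1 (\<lambda>n u. u * of_bool (P x n)) (N x))"
    by (intro computable_intros * assms)
  moreover have "rec_nat 1 (\<lambda>n u. u * of_bool (P x n)) m = (of_bool (\<forall>y<m. P x y) :: nat)" for x m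
    by (induction m) (auto simp: less_Suc_eq)
  ultimately show ?thesis by (simp add: dec_def)
qed

lemma dec_ex [computable_intros]:
  assumes "computable N" "dec (\<lambda>z. P (p1 z) (p2 z))"
  shows "dec (\<lambda>x. \<exists>y<N x. P x y)"
  using dec_not[OF dec_all[OF assms(1) dec_not[OF assms(2)]]] by simp

lemma computable_card [computable_intros]:
  assumes "computable N" "dec (\<lambda>z. P (p1 z) (p2 z))"
  shows "computable (\<lambda>x. card {y. y < N x \<and> P x y})"
proof -
  have *: "computable (\<lambda>z. of_bool (P (p1 z) (p1 (p2 z))))"
    using computable_compose[OF assms(2)[unfolded dec_def], of "\<lambda>z. prod_encode (p1 z, p1 (p2 z))"]
    by (simp add: computable_basic)
  have "computable (\<lambda>x. rec_nat 0 (\<lambda>n u. u + of_bool (P x n)) (N x))"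
    by (intro computable_intros * assms)
  moreover have "rec_nat 0 (\<lambda>n u. u + of_bool (P x n)) m = card {y. y < m \<and> P x y}" for x m
  proof (induction m)
    case (Suc m)
    have "{y. y < Suc m \<and> P x y} = (if P x m then insert m {y. y < m \<and> P x y} else {y. y < m \<and> P x y})"
      by (auto simp: less_Suc_eq)
    then show ?case using Suc by simp
  qed simp
  ultimately show ?thesis by simp
qed

lemma computable_div2 [computable_intros]:
  assumes "computable A" shows "computable (\<lambda>x. A x div 2)"
proof -
  have "computable (\<lambda>x. card {y. y < A x \<and> 2 * Suc y \<le> A x})"
    by (intro computable_intros assms assms[THEN computable_compose])
  moreover have "{y. y < a \<and> 2 * Suc y \<le> a} = {..<a div 2}" for a by auto
  ultimately show ?thesis by simp
qed

lemma dec_odd [computable_intros]: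
  assumes "computable A" shows "dec (\<lambda>x. odd (A x))"
proof -
  have "dec (\<lambda>x. A x \<noteq> 2 * (A x div 2))" by (intro computable_intros assms)
  moreover have "(a \<noteq> 2 * (a div 2)) = odd a" for a :: nat by presburger
  ultimately show ?thesis by simp
qed

text \<open>Bit \<open>A x\<close> of \<open>B x\<close> is the parity of the quotient by
  \<open>2 ^ A x\<close>, and that quotient counts the positive multiples of \<open>2 ^ A x\<close>
  up to \<open>B x\<close>.\<close>

lemma dec_set_decode [computable_intros]:
  assumes "computable A" "computable B" shows "dec (\<lambda>x. A x \<in> set_decode (B x))"
proof -
  have "computable (\<lambda>x. card {y. y < B x \<and> Suc y * 2 ^ A x \<le> B x})"
    by (intro computable_intros assms assms[THEN computable_compose])
  moreover have "{y. y < b \<and> Suc y * 2 ^ a \<le> b} = {..<b div 2 ^ a}" for a b :: nat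
  proof -
    have *: "Suc y * 2 ^ a \<le> b \<longleftrightarrow> y < b div 2 ^ a" for y
      using less_eq_div_iff_mult_less_eq[of "2 ^ a" "Suc y" b] by auto
    moreover have "b div 2 ^ a \<le> b" by simp
    ultimately show ?thesis unfolding lessThan_def using order_less_le_trans by blast
  qed
  ultimately have "computable (\<lambda>x. B x div 2 ^ A x)" by simp
  then show ?thesis unfolding set_decode_def mem_Collect_eq by (rule dec_odd)
qed

section \<open>A uniform enumeration of the c.e. sets\<close>

text \<open>Injectivity makes the choice in \<open>phi\<close> unambiguous, so \<open>phi\<close>
  decodes every program code.\<close>

lemma encode_inject: "encode r = encode r' \<longleftrightarrow> r = r'"
proof
  show "encode r = encode r' \<Longrightarrow> r = r'"
  proof (induction r arbitrary: r')
    case Zero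
    then show ?case by (cases r') auto
  next
    case Succ
    then show ?case by (cases r') auto
  next
    case (Proj i)
    then show ?case by (cases r') auto
  next
    case (Comp f gs)
    then obtain f' gs' where r': "r' = Comp f' gs'" "encode f = encode f'"
        "map encode gs = map encode gs'"
      by (cases r') (auto simp: list_encode_eq)
    have "gs = gs'"
      by (rule list.inj_map_strong[OF _ r'(3)]) (use Comp.IH(2) in blast)
    then show ?case using Comp.IH(1)[OF r'(2)] r'(1) by simp
  next
    case (Prec f g)
    then show ?case by (cases r') auto
  next
    case (Mini f)
    then show ?case by (cases r') auto
  qed
qed simp

lemma phi_encode: "phi (encode r) = r"
  by (auto simp: phi_def encode_inject)

text \<open>A nonempty list is coded by the successor of a pair and \<open>[]\<close> by 0.
  Truncated subtraction gives \<open>hdc 0 = 0\<close>, which matches the default value of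
  \<open>arg\<close>.\<close>

definition hdc :: "nat \<Rightarrow> nat" where "hdc y = p1 (y - 1)"
definition tlc :: "nat \<Rightarrow> nat" where "tlc y = p2 (y - 1)"
definition dropc :: "nat \<Rightarrow> nat \<Rightarrow> nat" where "dropc w y = rec_nat y (\<lambda>n u. tlc u) w"

lemma computable_hdc [computable_intros]: "computable A \<Longrightarrow> computable (\<lambda>x. hdc (A x))"
  unfolding hdc_def by (intro computable_intros)

lemma computable_tlc [computable_intros]: "computable A \<Longrightarrow> computable (\<lambda>x. tlc (A x))"
  unfolding tlc_def by (intro computable_intros)

lemma computable_dropc [computable_intros]:
  "computable A \<Longrightarrow> computable B \<Longrightarrow> computable (\<lambda>x. dropc (A x) (B x))"
  unfolding dropc_def by (intro computable_intros)

lemma prod_decode_0: "prod_decode 0 = (0, 0)"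
proof -
  have "prod_encode (0, 0) = 0" by (simp add: prod_encode_def)
  then show ?thesis by (metis prod_encode_inverse)
qed

lemma hdc_list_encode: "hdc (list_encode xs) = arg xs 0"
  by (cases xs) (simp_all add: hdc_def arg_def prod_decode_0)

lemma tlc_list_encode: "tlc (list_encode xs) = list_encode (tl xs)"
  by (cases xs) (simp_all add: tlc_def prod_decode_0)

lemma dropc_list_encode: "dropc w (list_encode xs) = list_encode (drop w xs)"
  by (induction w) (simp_all add: dropc_def tlc_list_encode drop_Suc tl_drop)

lemma hdc_dropc: "hdc (dropc w (list_encode xs)) = arg xs w"
  by (auto simp: dropc_list_encode hdc_list_encode arg_def)

lemma dropc_eq_0_iff: "dropc w (list_encode xs) = 0 \<longleftrightarrow> length xs \<le> w"
  by (metis drop_eq_Nil dropc_list_encode list_encode.simps(1) list_encode_eq)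

abbreviation pr :: "nat \<Rightarrow> nat \<Rightarrow> nat" where "pr a b \<equiv> prod_encode (a, b)"
abbreviation fact_code :: "nat \<Rightarrow> nat \<Rightarrow> nat \<Rightarrow> nat" where "fact_code e x v \<equiv> pr e (pr x v)"

text \<open>
  One inference step producing the fact coded by \<open>(e, x, v)\<close> from the facts in \<open>S\<close>, where \<open>w\<close> is a
  witness for an intermediate value.  If \<open>e\<close> has tag at most 5 the fact says that program \<open>e\<close> maps
  the list \<open>x\<close> to \<open>v\<close>.  Tag 6 evaluates a list of programs, tag 7 says that a program has positive
  values at all first arguments below \<open>v\<close>, and tags 8 and 9 say that a number is not the code of a
  program or of a list of programs.  The last two are needed because \<^const>\<open>W\<close> of an invalid code
  is all of \<open>\<nat>\<close>.
\<close>

definition step :: "nat set \<Rightarrow> nat \<Rightarrow> nat \<Rightarrow> nat \<Rightarrow> nat \<Rightarrow> bool" where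
  "step S e x v w \<longleftrightarrow>
     e = pr 0 0 \<and> v = 0 \<or>
     e = pr 1 0 \<and> v = Suc (hdc x) \<or>
     p1 e = 2 \<and> v = hdc (dropc (p2 e) x) \<or>
     p1 e = 3 \<and> fact_code (pr 6 (p2 (p2 e))) x w \<in> S \<and> fact_code (p1 (p2 e)) w v \<in> S \<or>
     p1 e = 4 \<and> x \<noteq> 0 \<and> hdc x = 0 \<and> fact_code (p1 (p2 e)) (tlc x) v \<in> S \<or>
     p1 e = 4 \<and> x \<noteq> 0 \<and> hdc x \<noteq> 0 \<and> fact_code e (Suc (pr (hdc x - 1) (tlc x))) w \<in> S \<and>
       fact_code (p2 (p2 e)) (Suc (pr w (Suc (pr (hdc x - 1) (tlc x))))) v \<in> S \<or>
     p1 e = 5 \<and> fact_code (pr 7 (p2 e)) x v \<in> S \<and> fact_code (p2 e) (Suc (pr v x)) 0 \<in> S \<or>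
     e = pr 6 0 \<and> v = 0 \<or>
     p1 e = 6 \<and> p2 e \<noteq> 0 \<and> v \<noteq> 0 \<and> fact_code (hdc (p2 e)) x (hdc v) \<in> S \<and>
       fact_code (pr 6 (tlc (p2 e))) x (tlc v) \<in> S \<or>
     p1 e = 7 \<and> v = 0 \<or>
     p1 e = 7 \<and> v \<noteq> 0 \<and> fact_code e x (v - 1) \<in> S \<and>
       fact_code (p2 e) (Suc (pr (v - 1) x)) (Suc w) \<in> S \<or>
     p1 e = 8 \<and> (6 \<le> p1 (p2 e) \<or> p1 (p2 e) < 2 \<and> p2 (p2 e) \<noteq> 0 \<or>
       p1 (p2 e) = 3 \<and> (fact_code (pr 8 (p1 (p2 (p2 e)))) 0 0 \<in> S \<or>
                        fact_code (pr 9 (p2 (p2 (p2 e)))) 0 0 \<in> S) \<or>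
       p1 (p2 e) = 4 \<and> (fact_code (pr 8 (p1 (p2 (p2 e)))) 0 0 \<in> S \<or>
                        fact_code (pr 8 (p2 (p2 (p2 e)))) 0 0 \<in> S) \<or>
       p1 (p2 e) = 5 \<and> fact_code (pr 8 (p2 (p2 e))) 0 0 \<in> S) \<or>
     p1 e = 9 \<and> p2 e \<noteq> 0 \<and> (fact_code (pr 8 (hdc (p2 e))) 0 0 \<in> S \<or>
       fact_code (pr 9 (tlc (p2 e))) 0 0 \<in> S)"

text \<open>The meaning of a fact, by the tag of \<open>e\<close>. It constrains genuine codes only,
  and the last two clauses say that facts with tag 8 or 9 never concern one.\<close>

definition sound :: "nat \<Rightarrow> nat \<Rightarrow> nat \<Rightarrow> bool" where
  "sound e x v \<longleftrightarrow>
     (\<forall>r. encode r = e \<longrightarrow> eval r (list_decode x) v) \<and>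
     (\<forall>rs. e = pr 6 (list_encode (map encode rs)) \<longrightarrow>
        list_all2 (\<lambda>r y. eval r (list_decode x) y) rs (list_decode v)) \<and>
     (\<forall>r. e = pr 7 (encode r) \<longrightarrow> (\<forall>m<v. \<exists>u. eval r (m # list_decode x) u \<and> 0 < u)) \<and>
     (\<forall>r. e \<noteq> pr 8 (encode r)) \<and>
     (\<forall>rs. e \<noteq> pr 9 (list_encode (map encode rs)))"

lemma list_decode_hdc_tlc: "y \<noteq> 0 \<Longrightarrow> list_decode y = hdc y # list_decode (tlc y)"
  by (cases y) (auto simp: hdc_def tlc_def split: prod.split)

text \<open>The tag of \<open>e\<close> leaves only the matching disjuncts of \<open>step\<close>.
  Subprograms of a genuine program are genuine, so the premises required to declare it invalid
  cannot lie in \<open>S\<close>.\<close>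

lemma step_sound:
  assumes S: "\<And>e x v. fact_code e x v \<in> S \<Longrightarrow> sound e x v" and st: "step S e x v w"
  shows "sound e x v"
  unfolding sound_def
proof (intro conjI allI impI)
  fix r assume e: "encode r = e"
  have ev: "eval r' (list_decode x') v'" if "fact_code (encode r') x' v' \<in> S" for r' x' v'
    using S[OF that] by (simp add: sound_def)
  show "eval r (list_decode x) v"
  proof (cases r)
    case Zero
    then show ?thesis using st e by (auto simp: step_def intro: eval.intros)
  next
    case Succ
    have "hdc x = arg (list_decode x) 0" by (metis hdc_list_encode list_decode_inverse)
    then show ?thesis using st e Succ by (auto simp: step_def intro: eval_Succ)
  next
    case (Proj i)
    have "hdc (dropc i x) = arg (list_decode x) i" by (metis hdc_dropc list_decode_inverse)
    then show ?thesis using st e Proj by (auto simp: step_def intro: eval_Proj)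
  next
    case (Comp f gs)
    then have "fact_code (pr 6 (list_encode (map encode gs))) x w \<in> S" "fact_code (encode f) w v \<in> S"
      using st e by (auto simp: step_def)
    then show ?thesis unfolding Comp
      using S[unfolded sound_def, of "pr 6 (list_encode (map encode gs))" x w]
      by (intro eval_Comp[where ys = "list_decode w"] ev) auto
  next
    case (Prec f g)
    \<comment> \<open>The code 0 of the empty list has \<open>hdc 0 = 0\<close>, but
      \<open>Prec\<close> has no value there, so \<open>step\<close> demands a nonempty
      list.\<close>
    have x: "x \<noteq> 0" using st e Prec by (auto simp: step_def)
    note xd = list_decode_hdc_tlc[OF x]
    show ?thesis
    proof (cases "hdc x")
      case 0
      then have "fact_code (encode f) (tlc x) v \<in> S" using st e Prec by (auto simp: step_def)
      then show ?thesis unfolding xd Prec 0 by (intro eval_Prec0 ev)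
    next
      case (Suc n)
      then have "fact_code (encode r) (Suc (pr n (tlc x))) w \<in> S"
          "fact_code (encode g) (Suc (pr w (Suc (pr n (tlc x))))) v \<in> S"
        using st e Prec by (auto simp: step_def)
      from this[THEN ev] show ?thesis unfolding xd Prec Suc by (auto intro: eval_PrecS)
    qed
  next
    case (Mini f)
    then have 1: "fact_code (pr 7 (encode f)) x v \<in> S" and "fact_code (encode f) (Suc (pr v x)) 0 \<in> S"
      using st e by (auto simp: step_def)
    from this(2)[THEN ev] show ?thesis
      using S[OF 1] unfolding Mini sound_def by (intro eval_Mini) auto
  qed
next
  fix rs assume e: "e = pr 6 (list_encode (map encode rs))"
  show "list_all2 (\<lambda>r y. eval r (list_decode x) y) rs (list_decode v)"
  proof (cases rs)
    case Nil
    then show ?thesis using st e by (auto simp: step_def)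
  next
    case (Cons r rs')
    then have v: "v \<noteq> 0" and "fact_code (encode r) x (hdc v) \<in> S"
        "fact_code (pr 6 (list_encode (map encode rs'))) x (tlc v) \<in> S"
      using st e by (auto simp: step_def hdc_def tlc_def)
    from this(2,3)[THEN S] show ?thesis
      unfolding list_decode_hdc_tlc[OF v] Cons by (auto simp: sound_def)
  qed
next
  fix r m assume e: "e = pr 7 (encode r)" and m: "m < v"
  then have "fact_code e x (v - 1) \<in> S" and 2: "fact_code (encode r) (Suc (pr (v - 1) x)) (Suc w) \<in> S"
    using st by (auto simp: step_def)
  from S[OF this(1)] have 1: "\<forall>m<v-1. \<exists>u. eval r (m # list_decode x) u \<and> 0 < u"
    using e by (auto simp: sound_def)
  from S[OF 2] have "eval r ((v - 1) # list_decode x) (Suc w)" by (auto simp: sound_def)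
  then show "\<exists>u. eval r (m # list_decode x) u \<and> 0 < u"
    using 1 m by (metis Suc_diff_1 less_Suc_eq not_less_zero zero_less_Suc gr0I)
next
  fix r
  have no: "fact_code (pr 8 (encode r')) x' v' \<notin> S" "fact_code (pr 9 (list_encode (map encode rs))) x' v' \<notin> S"
    for r' rs x' v'
    using S unfolding sound_def by blast+
  show "e \<noteq> pr 8 (encode r)"
    using st no by (cases r) (auto simp: step_def)
next
  fix rs
  have no: "fact_code (pr 8 (encode r')) x' v' \<notin> S" "fact_code (pr 9 (list_encode (map encode rs))) x' v' \<notin> S"
    for r' rs x' v'
    using S unfolding sound_def by blast+
  show "e \<noteq> pr 9 (list_encode (map encode rs))"
    using st no by (cases rs) (auto simp: step_def hdc_def tlc_def)
qed

text \<open>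
  The finite set of facts found by stage \<open>t\<close>, as a bit set.  Each \<open>t\<close> codes a fact, a witness and a
  padding number, so that every inference is tried at arbitrarily late stages.
\<close>

primrec stage :: "nat \<Rightarrow> nat" where
  "stage 0 = 0"
| "stage (Suc t) =
    (let a = p1 (p1 t) in
     if a \<notin> set_decode (stage t) \<and> step (set_decode (stage t)) (p1 a) (p1 (p2 a)) (p2 (p2 a)) (p2 (p1 t))
     then stage t + 2 ^ a else stage t)"

text \<open>\<open>stage\<close> adds \<open>2 ^ a\<close> only when bit \<open>a\<close> is clear,
  so the addition produces no carry and amounts to an insertion.\<close>

lemma stage_Suc_set:
  "set_decode (stage (Suc t)) = set_decode (stage t) \<union>
     {a. a = p1 (p1 t) \<and> step (set_decode (stage t)) (p1 a) (p1 (p2 a)) (p2 (p2 a)) (p2 (p1 t))}"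
proof -
  have "set_decode (n + 2 ^ a) = insert a (set_decode n)" if "a \<notin> set_decode n" for n a
    using set_encode_insert[OF finite_set_decode that] that
    by (metis add.commute finite_insert finite_set_decode set_decode_inverse set_encode_inverse)
  then show ?thesis by (auto simp: Let_def)
qed

lemma stage_mono: "s \<le> t \<Longrightarrow> set_decode (stage s) \<subseteq> set_decode (stage t)"
  by (rule lift_Suc_mono_le) (unfold stage_Suc_set, auto)

lemma stage_sound: "fact_code e x v \<in> set_decode (stage t) \<Longrightarrow> sound e x v"
proof (induction t arbitrary: e x v)
  case (Suc t)
  then show ?case unfolding stage_Suc_set
    using step_sound[OF Suc.IH, where e = e and x = x and v = v] by auto
qed simp

section \<open>Completeness of the inference system\<close>

definition derivable :: "nat \<Rightarrow> nat \<Rightarrow> nat \<Rightarrow> bool" where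
  "derivable e x v \<longleftrightarrow> (\<exists>t. fact_code e x v \<in> set_decode (stage t))"

text \<open>Lets completeness proofs ignore stages: finitely many premises are present together at
  some stage, after which the rule is tried again.\<close>

lemma derivableI:
  assumes st: "\<And>S. list_all (\<lambda>(e, x, v). fact_code e x v \<in> S) ps \<Longrightarrow> step S e x v w"
    and ps: "list_all (\<lambda>(e, x, v). derivable e x v) ps"
  shows "derivable e x v"
proof -
  have mono: "list_all (\<lambda>(e, x, v). fact_code e x v \<in> set_decode (stage t)) qs"
    if "list_all (\<lambda>(e, x, v). fact_code e x v \<in> set_decode (stage s)) qs" "s \<le> t" for s t qs
    using that(1) by (rule list.pred_mono_strong) (use stage_mono[OF that(2)] in auto)
  have "\<exists>t. list_all (\<lambda>(e, x, v). fact_code e x v \<in> set_decode (stage t)) ps"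
    using ps
  proof (induction ps)
    case (Cons p ps)
    obtain e x v where p: "p = (e, x, v)" by (cases p)
    obtain t where t: "list_all (\<lambda>(e, x, v). fact_code e x v \<in> set_decode (stage t)) ps"
      using Cons.IH Cons.prems by (meson list.pred_inject(2))
    obtain t' where "fact_code e x v \<in> set_decode (stage t')"
      using Cons.prems p by (auto simp: derivable_def)
    then show ?case
      using mono[OF t max.cobounded1, of t'] stage_mono[OF max.cobounded2, of t' t]
      unfolding p list.pred_inject(2) prod.case by blast
  qed simp
  then obtain t where t: "list_all (\<lambda>(e, x, v). fact_code e x v \<in> set_decode (stage t)) ps" ..
  \<comment> \<open>With \<open>t\<close> as padding, the stage number is at least \<open>t\<close>,
    and this fact is tried there with this witness.\<close>
  let ?t = "pr (pr (fact_code e x v) w) t"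
  have "step (set_decode (stage ?t)) e x v w"
    by (intro st mono[OF t] le_prod_encode_2)
  then have "fact_code e x v \<in> set_decode (stage (Suc ?t))" unfolding stage_Suc_set by simp
  then show ?thesis unfolding derivable_def by blast
qed

lemma derivable_list:
  assumes "list_all2 (\<lambda>g y. derivable (encode g) x y) gs ys"
  shows "derivable (pr 6 (list_encode (map encode gs))) x (list_encode ys)"
  using assms
proof (induction rule: list_all2_induct)
  case Nil
  show ?case by (rule derivableI[where ps = "[]"]) (auto simp: step_def)
next
  case (Cons g gs y ys)
  then show ?case
    by (intro derivableI[where ps = "[(encode g, x, y), (pr 6 (list_encode (map encode gs)), x, list_encode ys)]"])
       (auto simp: step_def hdc_def tlc_def)
qed

lemma eval_derivable: "eval r xs v \<Longrightarrow> derivable (encode r) (list_encode xs) v"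
proof (induction rule: eval.induct)
  case (eval_Zero xs)
  show ?case by (rule derivableI[where ps = "[]"]) (auto simp: step_def)
next
  case (eval_Succ xs)
  show ?case by (rule derivableI[where ps = "[]"]) (auto simp: step_def hdc_list_encode)
next
  case (eval_Proj i xs)
  show ?case by (rule derivableI[where ps = "[]"]) (auto simp: step_def hdc_dropc)
next
  case (eval_Comp xs gs ys f v)
  have "derivable (pr 6 (list_encode (map encode gs))) (list_encode xs) (list_encode ys)"
    by (rule derivable_list) (use eval_Comp.IH(1) in \<open>auto elim: list_all2_mono\<close>)
  with eval_Comp.IH(2) show ?case
    by (intro derivableI[where w = "list_encode ys" and ps =
          "[(pr 6 (list_encode (map encode gs)), list_encode xs, list_encode ys), (encode f, list_encode ys, v)]"])
       (auto simp: step_def)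
next
  case (eval_Prec0 f xs v g)
  then show ?case
    by (intro derivableI[where ps = "[(encode f, list_encode xs, v)]"])
       (auto simp: step_def hdc_def tlc_def)
next
  case (eval_PrecS f g n xs u v)
  then show ?case
    by (intro derivableI[where w = u and ps = "[(encode (Prec f g), list_encode (n # xs), u),
          (encode g, list_encode (u # n # xs), v)]"])
       (auto simp: step_def hdc_def tlc_def)
next
  case (eval_Mini f n xs)
  \<comment> \<open>The positivity claim needed for minimisation is built up one argument at a
    time.\<close>
  have "derivable (pr 7 (encode f)) (list_encode xs) k" if "k \<le> n" for k
    using that
  proof (induction k)
    case 0
    show ?case by (rule derivableI[where ps = "[]"]) (auto simp: step_def)
  next
    case (Suc k)
    then obtain u where "derivable (encode f) (list_encode (k # xs)) (Suc u)"
      using eval_Mini.IH(2) by (metis Suc_le_lessD gr0_implies_Suc)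
    then show ?case using Suc
      by (intro derivableI[where w = u and ps = "[(pr 7 (encode f), list_encode xs, k),
            (encode f, list_encode (k # xs), Suc u)]"]) (auto simp: step_def)
  qed
  from this[of n] eval_Mini.IH(1) show ?case
    by (intro derivableI[where ps = "[(pr 7 (encode f), list_encode xs, n),
            (encode f, list_encode (n # xs), 0)]"]) (auto simp: step_def)
qed

text \<open>An invalid list has an invalid head or an invalid tail. The assumption covers only
  numbers below \<open>gs\<close>, so the induction in \<open>invalid_derivable\<close> can supply
  it.\<close>

lemma invalid_list_derivable:
  assumes "\<And>e. e < gs \<Longrightarrow> \<nexists>r. encode r = e \<Longrightarrow> derivable (pr 8 e) 0 0"
  shows "\<nexists>rs. list_encode (map encode rs) = gs \<Longrightarrow> derivable (pr 9 gs) 0 0"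
  using assms
proof (induction gs rule: less_induct)
  case (less gs)
  have "gs \<noteq> 0" using less.prems(1) by (metis list.simps(8) list_encode.simps(1))
  then obtain a b where gs: "gs = Suc (pr a b)" by (metis not0_implies_Suc prod_decode_inverse surj_pair)
  have lt: "a < gs" "b < gs" using le_prod_encode_1[of a b] le_prod_encode_2[of b a] gs by auto
  show ?case
  proof (cases "\<exists>r. encode r = a")
    case True
    then obtain r where r: "encode r = a" by blast
    have "\<nexists>rs. list_encode (map encode rs) = b"
    proof
      assume "\<exists>rs. list_encode (map encode rs) = b"
      then obtain rs where "list_encode (map encode rs) = b" by blast
      then have "list_encode (map encode (r # rs)) = gs" using r gs by simp
      then show False using less.prems(1) by blast
    qed
    then have "derivable (pr 9 b) 0 0" using less.IH[OF lt(2)] less.prems(2) lt(2) by (meson order.strict_trans)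
    then show ?thesis using gs
      by (intro derivableI[where ps = "[(pr 9 b, 0, 0)]"]) (auto simp: step_def hdc_def tlc_def)
  next
    case False
    then have "derivable (pr 8 a) 0 0" using less.prems(2) lt(1) by blast
    then show ?thesis using gs
      by (intro derivableI[where ps = "[(pr 8 a, 0, 0)]"]) (auto simp: step_def hdc_def tlc_def)
  qed
qed

lemma invalid_derivable: "\<nexists>r. encode r = e \<Longrightarrow> derivable (pr 8 e) 0 0"
proof (induction e rule: less_induct)
  case (less e)
  obtain k p where e: "e = pr k p" by (metis prod_decode_inverse surj_pair)
  obtain a b where p: "p = pr a b" by (metis prod_decode_inverse surj_pair)
  \<comment> \<open>Positivity of the tag is what makes the payload strictly smaller:
    \<open>pr 0 1 = 1\<close>.\<close>
  have pe: "p < e" if "k > 0"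
  proof -
    have "p < k + p" using that by simp
    also have "k + p \<le> triangle (k + p) + k" using that by (induction k) auto
    finally show ?thesis by (simp add: e prod_encode_def)
  qed
  have ap: "a \<le> p" "b \<le> p" using le_prod_encode_1[of a b] le_prod_encode_2[of b a] p by auto
  have inv: "derivable (pr 8 c) 0 0" if "c \<le> p" "k > 0" "\<nexists>r. encode r = c" for c
    using less.IH[of c] that pe by simp
  have *: "derivable (pr 8 e) 0 0" if "derivable f 0 0"
    "\<And>S. fact_code f 0 0 \<in> S \<Longrightarrow> step S (pr 8 e) 0 0 0" for f
    using that by (intro derivableI[where ps = "[(f, 0, 0)]"]) auto
  consider "k \<ge> 6" | "k = 0" | "k = 1" | "k = 2" | "k = 3" | "k = 4" | "k = 5" by linarith
  then show ?case
  proof cases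
    case 1
    then show ?thesis using e by (intro derivableI[where ps = "[]"]) (auto simp: step_def)
  next
    case 2
    then have "p \<noteq> 0" using less.prems e by (metis encode.simps(1))
    then show ?thesis using e 2 by (intro derivableI[where ps = "[]"]) (auto simp: step_def)
  next
    case 3
    then have "p \<noteq> 0" using less.prems e by (metis encode.simps(2))
    then show ?thesis using e 3 by (intro derivableI[where ps = "[]"]) (auto simp: step_def)
  next
    case 4
    then show ?thesis using less.prems e by (metis encode.simps(3))
  next
    case 5
    show ?thesis
    proof (cases "\<exists>r. encode r = a")
      case True
      then have "\<nexists>rs. list_encode (map encode rs) = b"
        using less.prems 5 e p by (metis encode.simps(4))
      then have "derivable (pr 9 b) 0 0"
        using invalid_list_derivable[of b] inv 5 ap by (metis less_or_eq_imp_le order_trans zero_less_numeral)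
      then show ?thesis by (rule *) (use 5 e p in \<open>auto simp: step_def\<close>)
    next
      case False
      then have "derivable (pr 8 a) 0 0" using inv ap 5 by simp
      then show ?thesis by (rule *) (use 5 e p in \<open>auto simp: step_def\<close>)
    qed
  next
    case 6
    show ?thesis
    proof (cases "\<exists>r. encode r = a")
      case True
      then have "\<nexists>r. encode r = b"
        using less.prems 6 e p by (metis encode.simps(5))
      then have "derivable (pr 8 b) 0 0" using inv ap 6 by simp
      then show ?thesis by (rule *) (use 6 e p in \<open>auto simp: step_def\<close>)
    next
      case False
      then have "derivable (pr 8 a) 0 0" using inv ap 6 by simp
      then show ?thesis by (rule *) (use 6 e p in \<open>auto simp: step_def\<close>)
    qed
  next
    case 7
    then have "\<nexists>r. encode r = p" using less.prems e by (metis encode.simps(6))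
    then have "derivable (pr 8 p) 0 0" using inv 7 by simp
    then show ?thesis by (rule *) (use 7 e in \<open>auto simp: step_def\<close>)
  qed
qed

text \<open>An invalid \<open>e\<close> enumerates every \<open>x\<close>, because
  \<open>phi e\<close> is then \<open>Zero\<close>. \<open>Suc (pr x 0)\<close> codes the list
  \<open>[x]\<close>, and the bound on \<open>v\<close> keeps the predicate decidable.\<close>

definition Wst :: "nat \<Rightarrow> nat \<Rightarrow> nat \<Rightarrow> bool" where
  "Wst e s x \<longleftrightarrow> fact_code (pr 8 e) 0 0 \<in> set_decode (stage s) \<or>
     (\<exists>v<s. fact_code e (Suc (pr x 0)) v \<in> set_decode (stage s))"

lemma Wst_mono: "s \<le> t \<Longrightarrow> Wst e s x \<Longrightarrow> Wst e t x"
  unfolding Wst_def using stage_mono[of s t] by (meson order_less_le_trans subsetD)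

lemma W_iff_Wst: "x \<in> W e \<longleftrightarrow> (\<exists>s. Wst e s x)"
proof (cases "\<exists>r. encode r = e")
  case True
  then obtain r where r: "encode r = e" by blast
  have x: "list_encode [x] = Suc (pr x 0)" by simp
  have "\<exists>s. Wst e s x" if ev: "eval r [x] v" for v
  proof -
    obtain t where "fact_code e (Suc (pr x 0)) v \<in> set_decode (stage t)"
      using eval_derivable[OF ev] r x by (auto simp: derivable_def)
    \<comment> \<open>The later stage also puts \<open>v\<close> below the search bound of
      \<open>Wst\<close>.\<close>
    then have "fact_code e (Suc (pr x 0)) v \<in> set_decode (stage (max t (Suc v)))"
      using stage_mono[of t "max t (Suc v)"] by auto
    then have "Wst e (max t (Suc v)) x" unfolding Wst_def by (metis lessI less_max_iff_disj)
    then show ?thesis ..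
  qed
  moreover have "\<exists>v. eval r [x] v" if st: "Wst e s x" for s
  proof -
    have "fact_code (pr 8 e) 0 0 \<notin> set_decode (stage s)"
      using stage_sound[of "pr 8 e" 0 0 s] r by (auto simp: sound_def)
    then obtain v where "fact_code e (Suc (pr x 0)) v \<in> set_decode (stage s)"
      using st by (auto simp: Wst_def)
    from stage_sound[OF this] show ?thesis using r by (auto simp: sound_def)
  qed
  ultimately show ?thesis using r phi_encode[of r] by (auto simp: W_def)
next
  case False
  then have "eval (phi e) [x] 0" by (auto simp: phi_def intro: eval_Zero)
  moreover have "\<exists>s. Wst e s x" using invalid_derivable[OF False] by (auto simp: derivable_def Wst_def)
  ultimately show ?thesis by (auto simp: W_def)
qed

lemma dec_step [computable_intros]:
  assumes "computable Z" "computable E" "computable X" "computable V" "computable U"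
  shows "dec (\<lambda>x. step (set_decode (Z x)) (E x) (X x) (V x) (U x))"
  unfolding step_def by (intro computable_intros assms)

lemma computable_stage [computable_intros]:
  assumes "computable A" shows "computable (\<lambda>x. stage (A x))"
proof -
  have "stage t = rec_nat 0 (\<lambda>t u. if p1 (p1 t) \<notin> set_decode u \<and>
      step (set_decode u) (p1 (p1 (p1 t))) (p1 (p2 (p1 (p1 t)))) (p2 (p2 (p1 (p1 t)))) (p2 (p1 t))
     then u + 2 ^ p1 (p1 t) else u) t" for t
    by (induction t) (simp_all add: Let_def)
  then show ?thesis by (simp only:) (intro computable_intros assms)
qed

lemma dec_Wst [computable_intros]:
  assumes "computable E" "computable S" "computable X"
  shows "dec (\<lambda>x. Wst (E x) (S x) (X x))"
  unfolding Wst_def by (intro computable_intros assms assms[THEN computable_compose])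

section \<open>Constant programs and the s-m-n theorem\<close>

primrec const_rec :: "nat \<Rightarrow> recf" where
  "const_rec 0 = Zero"
| "const_rec (Suc n) = Comp Succ [const_rec n]"

lemma eval_const_rec: "eval (const_rec n) xs n"
proof (induction n)
  case (Suc n)
  then show ?case
    using eval_Comp[of xs "[const_rec n]" "[n]" Succ "Suc n"] eval_Succ[of "[n]"] by simp
qed (auto intro: eval_Zero)

lemma computable_encode_const_rec: "computable (\<lambda>n. encode (const_rec n))"
proof -
  have "encode (const_rec n) =
    rec_nat (pr 0 0) (\<lambda>n u. pr 3 (pr (pr 1 0) (Suc (pr u 0)))) n" for n
    by (induction n) auto
  then show ?thesis by (simp only:) (intro computable_intros)
qed

text \<open>Unbounded search for \<open>s\<close> semidecides the existential statement, and
  precomposing with the constant program for \<open>i\<close> hardwires the parameter. The code of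
  the result is a computable function of \<open>i\<close>.\<close>

lemma smn_uniformly_ce:
  assumes "dec (\<lambda>z. R (p1 z) (p1 (p2 z)) (p2 (p2 z)))"
  shows "\<exists>g. computable g \<and> (\<forall>i. W (g i) = {x. \<exists>s. R i x s})"
proof -
  \<comment> \<open>\<open>Mini\<close> searches for a zero, hence the negation.\<close>
  have "computable (\<lambda>z. of_bool (\<not> R (p1 z) (p1 (p2 z)) (p2 (p2 z))))"
    using dec_not[OF assms] by (simp add: dec_def)
  then have "rc (\<lambda>xs. (\<lambda>z. of_bool (\<not> R (p1 z) (p1 (p2 z)) (p2 (p2 z))))
      (pr (arg xs 1) (pr (arg xs 2) (arg xs 0))))"
    by (rule computable_imp_rc) (intro rc_prod_encode rc_arg)
  then obtain r where "\<And>xs. eval r xs (of_bool (\<not> R (arg xs 1) (arg xs 2) (arg xs 0)))"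
    by (auto simp: rc_def)
  from this[of "[_, _, _]"] have r: "eval r [s, i, x] (of_bool (\<not> R i x s))" for i x s
    by (simp add: numeral_2_eq_2)
  have M: "(\<exists>v. eval (Mini r) [i, x] v) \<longleftrightarrow> (\<exists>s. R i x s)" for i x
  proof
    assume "\<exists>v. eval (Mini r) [i, x] v"
    then obtain v where "eval r [v, i, x] 0" by (auto elim: eval_MiniE)
    from eval_deterministic[OF this r] show "\<exists>s. R i x s" by (auto split: if_splits)
  next
    assume "\<exists>s. R i x s"
    then have L: "R i x (LEAST s. R i x s)" by (auto intro: LeastI)
    have "eval (Mini r) [i, x] (LEAST s. R i x s)"
    proof (rule eval_Mini)
      show "eval r [LEAST s. R i x s, i, x] 0" using r[of "LEAST s. R i x s" i x] L by simp
      show "\<forall>m<LEAST s. R i x s. \<exists>v. eval r [m, i, x] v \<and> 0 < v"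
        using r not_less_Least by (metis (mono_tags, lifting) of_bool_eq(2) zero_less_one)
    qed
    then show "\<exists>v. eval (Mini r) [i, x] v" ..
  qed
  define G where "G i = Comp (Mini r) [const_rec i, Proj 0]" for i
  have "(\<exists>v. eval (G i) [x] v) \<longleftrightarrow> (\<exists>v. eval (Mini r) [i, x] v)" for i x
  proof
    assume "\<exists>v. eval (G i) [x] v"
    then obtain v a b where v: "eval (const_rec i) [x] a" "eval (Proj 0) [x] b" "eval (Mini r) [a, b] v"
      unfolding G_def by (auto elim!: eval_CompE simp: list_all2_Cons1)
    then have "a = i" "b = x"
      using eval_deterministic eval_const_rec eval_Proj[of 0 "[x]"] by (metis, metis arg_Cons(1))
    then show "\<exists>v. eval (Mini r) [i, x] v" using v by blast
  next
    assume "\<exists>v. eval (Mini r) [i, x] v"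
    then obtain v where "eval (Mini r) [i, x] v" ..
    then have "eval (G i) [x] v"
      unfolding G_def using eval_const_rec eval_Proj[of 0 "[x]"]
      by (intro eval_Comp[where ys = "[i, x]"]) auto
    then show "\<exists>v. eval (G i) [x] v" ..
  qed
  then have "W (encode (G i)) = {x. \<exists>s. R i x s}" for i
    using M by (simp add: W_def phi_encode)
  moreover have "computable (\<lambda>i. encode (G i))"
    unfolding G_def by simp (intro computable_intros computable_encode_const_rec)
  ultimately show ?thesis by blast
qed

section \<open>Density zero\<close>

text \<open>A form without division, in which natural numbers can be compared effectively.\<close>

lemma Z0ce_iff:
  "Z0ce i j \<longleftrightarrow> (\<forall>k. \<exists>N. \<forall>n\<ge>N. 2 ^ k * card (symdiff (W i) (W j) \<inter> {0..<n}) \<le> n)"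
    (is "_ \<longleftrightarrow> (\<forall>k. \<exists>N. \<forall>n\<ge>N. 2 ^ k * ?c n \<le> n)")
proof
  assume z: "Z0ce i j"
  show "\<forall>k. \<exists>N. \<forall>n\<ge>N. 2 ^ k * ?c n \<le> n"
  proof
    fix k
    obtain N where N: "\<forall>n\<ge>N. \<bar>real (?c n) / real n\<bar> < 1 / 2 ^ k"
      using LIMSEQ_D[OF z[unfolded Z0ce_def], of "1 / 2 ^ k"] by auto
    have "2 ^ k * ?c n \<le> n" if "n \<ge> N" for n
    proof (cases "n = 0")
      case False
      then have "real (?c n) * 2 ^ k < real n"
        using N that by (auto simp: field_simps)
      then have "real (2 ^ k * ?c n) \<le> real n" by (simp add: mult.commute)
      then show ?thesis by (simp only: of_nat_le_iff)
    qed simp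
    then show "\<exists>N. \<forall>n\<ge>N. 2 ^ k * ?c n \<le> n" by blast
  qed
next
  assume *: "\<forall>k. \<exists>N. \<forall>n\<ge>N. 2 ^ k * ?c n \<le> n"
  show "Z0ce i j"
    unfolding Z0ce_def
  proof (rule LIMSEQ_I)
    fix r :: real assume "r > 0"
    then obtain k where k: "(1 / 2) ^ k < r" using real_arch_pow_inv[of r "1 / 2"] by auto
    obtain N where N: "\<forall>n\<ge>N. 2 ^ k * ?c n \<le> n" using * by blast
    have "norm (real (?c n) / real n - 0) < r" if "n \<ge> Suc N" for n
    proof -
      have "2 ^ k * ?c n \<le> n" using N that by auto
      then have "real (2 ^ k * ?c n) \<le> real n" by (simp only: of_nat_le_iff)
      then have "real (?c n) / real n \<le> (1 / 2) ^ k" using that by (simp add: field_simps)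
      then show ?thesis using k by simp
    qed
    then show "\<exists>no. \<forall>n\<ge>no. norm (real (?c n) / real n - 0) < r" by blast
  qed
qed

section \<open>Reducing \<open>E3\<close> to \<open>Z0\<close>\<close>

definition block :: "nat \<Rightarrow> nat \<Rightarrow> nat \<Rightarrow> bool" where
  "block x n m \<longleftrightarrow> 2 ^ x \<le> m \<and> m < 2 ^ Suc x \<and> (\<exists>q. m = 2 ^ n * Suc (2 * q))"

text \<open>\<open>x\<close> is the position of the leading binary digit of \<open>m\<close> and
  \<open>n\<close> its 2-adic valuation, so each number is controlled by at most one pair.\<close>

lemma block_unique:
  assumes "block x n m" "block x' n' m" shows "x = x' \<and> n = n'"
proof
  have "x \<le> x'" if "(2::nat) ^ x \<le> m" "m < 2 ^ Suc x'" for x x'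
    using that by (metis leD leI le_less_trans less_Suc_eq_le one_less_numeral_iff power_less_imp_less_exp semiring_norm(76))
  then show "x = x'" using assms unfolding block_def by (meson le_antisym)
  have no: False if eq: "2 ^ n * Suc (2 * q) = 2 ^ n' * Suc (2 * q')" and lt: "n < n'" for n n' q q' :: nat
  proof -
    obtain d where "n' = Suc (n + d)" using lt less_imp_Suc_add by blast
    then have "2 ^ n * Suc (2 * q) = 2 ^ n * (2 * (2 ^ d * Suc (2 * q')))"
      using eq by (simp only: power_add power_Suc mult_ac)
    then have "Suc (2 * q) = 2 * (2 ^ d * Suc (2 * q'))" by (subst (asm) mult_cancel1) simp
    then show False by presburger
  qed
  show "n = n'" using assms no unfolding block_def by (metis linorder_neqE_nat)
qed

text \<open>The odd multiples \<open>2 ^ n * (2 * q + 1)\<close> with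
  \<open>2 ^ (x - n - 1) <= q < 2 ^ (x - n)\<close> lie in the block.\<close>

lemma card_block:
  assumes "n < x" shows "2 ^ (x - Suc n) \<le> card {m. block x n m}"
proof -
  let ?f = "\<lambda>q. 2 ^ n * Suc (2 * q)"
  let ?h = "2 ^ (x - Suc n) :: nat"
  have h: "2 ^ n * (2 * ?h) = 2 ^ x" using assms
    by (metis Suc_diff_Suc add_diff_inverse_nat less_imp_not_less power_Suc power_add)
  have "?f ` {?h..<2 * ?h} \<subseteq> {m. block x n m}"
  proof safe
    fix q assume "q \<in> {?h..<2 * ?h}"
    then have "2 * ?h \<le> Suc (2 * q)" "Suc (2 * q) < 2 * (2 * ?h)" by auto
    then have "2 ^ n * (2 * ?h) \<le> ?f q" "?f q < 2 ^ n * (2 * (2 * ?h))"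
      by (simp_all only: mult_le_mono2 mult_less_mono2 zero_less_power zero_less_numeral)
    then show "block x n (?f q)" using h unfolding block_def by auto
  qed
  moreover have "finite {m. block x n m}"
    by (rule finite_subset[of _ "{..<2 ^ Suc x}"]) (auto simp: block_def)
  ultimately have "card (?f ` {?h..<2 * ?h}) \<le> card {m. block x n m}" by (intro card_mono)
  moreover have "card (?f ` {?h..<2 * ?h}) = ?h" by (subst card_image) (auto simp: inj_on_def)
  ultimately show ?thesis by simp
qed

lemma E3ce_reducible_Z0ce: "creducible E3ce Z0ce"
proof -
  \<comment> \<open>The witness \<open>s\<close> codes \<open>x\<close>, \<open>n\<close>, the
    cofactor \<open>q\<close> and an enumeration stage.\<close>
  let ?R = "\<lambda>e m s. 2 ^ p1 s \<le> m \<and> m < 2 ^ Suc (p1 s) \<and>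
    m = 2 ^ p1 (p2 s) * Suc (2 * p1 (p2 (p2 s))) \<and> Wst e (p2 (p2 (p2 s))) (pr (p1 s) (p1 (p2 s)))"
  have "dec (\<lambda>z. ?R (p1 z) (p1 (p2 z)) (p2 (p2 z)))" by (intro computable_intros)
  from smn_uniformly_ce[OF this] obtain g where g: "computable g" "\<And>e. W (g e) = {m. \<exists>s. ?R e m s}"
    by blast
  have mem: "m \<in> W (g e) \<longleftrightarrow> (\<exists>x n. block x n m \<and> pr x n \<in> W e)" for e m
  proof
    assume "m \<in> W (g e)"
    then obtain s where s: "?R e m s" unfolding g(2) mem_Collect_eq ..
    then show "\<exists>x n. block x n m \<and> pr x n \<in> W e" unfolding block_def W_iff_Wst by blast
  next
    assume "\<exists>x n. block x n m \<and> pr x n \<in> W e"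
    then obtain x n q t where "2 ^ x \<le> m" "m < 2 ^ Suc x" "m = 2 ^ n * Suc (2 * q)" "Wst e t (pr x n)"
      unfolding block_def W_iff_Wst by blast
    then have "?R e m (pr x (pr n (pr q t)))" unfolding prod_encode_inverse fst_conv snd_conv by blast
    then show "m \<in> W (g e)" unfolding g(2) mem_Collect_eq by blast
  qed
  have sd: "m \<in> symdiff (W (g i)) (W (g j)) \<longleftrightarrow>
      (\<exists>x n. block x n m \<and> x \<in> symdiff (column (W i) n) (column (W j) n))" for i j m
    unfolding symdiff_def column_def using mem block_unique by blast
  have "E3ce i j \<longleftrightarrow> Z0ce (g i) (g j)" for i j
  proof
    assume e: "E3ce i j"
    let ?S = "symdiff (W (g i)) (W (g j))"
    have "\<exists>N. \<forall>m\<ge>N. 2 ^ k * card (?S \<inter> {0..<m}) \<le> m" for k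
    proof -
      have "finite (\<Union>n\<le>k. symdiff (column (W i) n) (column (W j) n))"
        using e by (simp add: E3ce_def)
      then obtain X where X: "\<And>n x. n \<le> k \<Longrightarrow> x \<in> symdiff (column (W i) n) (column (W j) n) \<Longrightarrow> x < X"
        unfolding finite_nat_set_iff_bounded by blast
      \<comment> \<open>The spare factor 2 pays for bounding two summands by \<open>m\<close>
        each.\<close>
      let ?K = "2 ^ Suc k :: nat"
      have "2 ^ k * card (?S \<inter> {0..<m}) \<le> m" if m: "m \<ge> ?K * (2 ^ X + 1)" for m
      proof -
        have "?S \<inter> {0..<m} \<subseteq> {0..<2 ^ X} \<union> (\<lambda>c. ?K * c) ` {0..m div ?K}"
        proof
          fix a assume a: "a \<in> ?S \<inter> {0..<m}"
          then obtain x n where b: "block x n a" "x \<in> symdiff (column (W i) n) (column (W j) n)"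
            using sd by blast
          show "a \<in> {0..<2 ^ X} \<union> (\<lambda>c. ?K * c) ` {0..m div ?K}"
          proof (cases "x < X")
            case True
            then have "(2::nat) ^ Suc x \<le> 2 ^ X" by (intro power_increasing) auto
            then show ?thesis using b(1) by (auto simp: block_def)
          next
            case False
            \<comment> \<open>From \<open>X\<close> on, differences occur only in columns above
              \<open>k\<close>, and these control multiples of \<open>?K\<close> only.\<close>
            then have "k < n" using X[of n x] b(2) by force
            then have "?K dvd 2 ^ n" by (intro le_imp_power_dvd) auto
            then have "?K dvd a" using b(1) by (auto simp: block_def)
            then obtain c where c: "a = ?K * c" ..
            then have "c \<le> m div ?K" using a by (simp add: less_eq_div_iff_mult_less_eq mult.commute)
            then show ?thesis using c by auto
          qed
        qed
        then have "card (?S \<inter> {0..<m}) \<le> card ({0..<2 ^ X} \<union> (\<lambda>c. ?K * c) ` {0..m div ?K})"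
          by (intro card_mono) auto
        also have "\<dots> \<le> card {0..<2 ^ X :: nat} + card ((\<lambda>c. ?K * c) ` {0..m div ?K})"
          by (rule card_Un_le)
        also have "\<dots> \<le> 2 ^ X + Suc (m div ?K)"
          using card_image_le[of "{0..m div ?K}" "\<lambda>c. ?K * c"] by simp
        finally have "?K * card (?S \<inter> {0..<m}) \<le> ?K * (2 ^ X + Suc (m div ?K))"
          by (rule mult_le_mono2)
        also have "\<dots> = ?K * (2 ^ X + 1) + ?K * (m div ?K)" by (simp add: algebra_simps)
        also have "\<dots> \<le> m + m" using m by (intro add_mono) auto
        finally show ?thesis by simp
      qed
      then show ?thesis by blast
    qed
    then show "Z0ce (g i) (g j)" by (simp add: Z0ce_iff)
  next
    assume z: "Z0ce (g i) (g j)"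
    let ?S = "symdiff (W (g i)) (W (g j))"
    show "E3ce i j"
      unfolding E3ce_def
    proof (rule allI, rule ccontr)
      fix n assume inf: "infinite (symdiff (column (W i) n) (column (W j) n))"
      \<comment> \<open>A block with \<open>x > n\<close> fills at least the fraction
        \<open>1 / 2 ^ (n + 2)\<close> of \<open>[0, 2 ^ (x + 1))\<close>, so the exponent
        \<open>n + 3\<close> overshoots by one.\<close>
      obtain N where N: "\<forall>m\<ge>N. 2 ^ (n + 3) * card (?S \<inter> {0..<m}) \<le> m"
        using z unfolding Z0ce_iff by blast
      obtain x where x: "x > max n N" "x \<in> symdiff (column (W i) n) (column (W j) n)"
        using inf unfolding finite_nat_set_iff_bounded by (meson leI less_Suc_eq_le not_less_eq)
      have "{m. block x n m} \<subseteq> ?S" using x(2) sd by blast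
      moreover have "{m. block x n m} \<subseteq> {0..<2 ^ Suc x}" by (auto simp: block_def)
      ultimately have "{m. block x n m} \<subseteq> ?S \<inter> {0..<2 ^ Suc x}" by blast
      then have "card {m. block x n m} \<le> card (?S \<inter> {0..<2 ^ Suc x})" by (intro card_mono) auto
      then have "2 ^ (x - Suc n) \<le> card (?S \<inter> {0..<2 ^ Suc x})"
        using card_block[of n x] x(1) by simp
      then have "2 ^ (n + 3) * 2 ^ (x - Suc n) \<le> 2 ^ (n + 3) * card (?S \<inter> {0..<2 ^ Suc x})"
        by (rule mult_le_mono2)
      also have "\<dots> \<le> 2 ^ Suc x"
      proof -
        have "x < 2 ^ x" by (rule less_exp)
        then have "N \<le> 2 ^ Suc x" using x(1) unfolding power_Suc max_less_iff_conj by linarith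
        then show ?thesis using N by blast
      qed
      finally have "(2::nat) ^ (n + 3 + (x - Suc n)) \<le> 2 ^ Suc x" by (simp only: power_add)
      then show False using x(1) by simp
    qed
  qed
  then show ?thesis using g(1) unfolding creducible_def by blast
qed

section \<open>Reducing \<open>Z0\<close> to \<open>E3\<close>\<close>

definition diff_count :: "nat \<Rightarrow> nat \<Rightarrow> nat \<Rightarrow> nat" where
  "diff_count a b n = card (symdiff (W a) (W b) \<inter> {0..<n})"

definition diff_count_at :: "nat \<Rightarrow> nat \<Rightarrow> nat \<Rightarrow> nat \<Rightarrow> nat" where
  "diff_count_at t a b n = card {y. y < n \<and> Wst a t y \<noteq> Wst b t y}"

lemma diff_count_commute: "diff_count a b n = diff_count b a n"
  by (simp add: diff_count_def symdiff_def Un_commute)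

lemma diff_count_triangle: "diff_count a c n \<le> diff_count a b n + diff_count b c n"
proof -
  have "diff_count a c n \<le> card (symdiff (W a) (W b) \<inter> {0..<n} \<union> symdiff (W b) (W c) \<inter> {0..<n})"
    unfolding diff_count_def by (rule card_mono) (auto simp: symdiff_def)
  also have "\<dots> \<le> diff_count a b n + diff_count b c n"
    unfolding diff_count_def by (rule card_Un_le)
  finally show ?thesis .
qed

lemma Wst_settles: "\<exists>s. \<forall>t\<ge>s. \<forall>y<n. Wst e t y \<longleftrightarrow> y \<in> W e"
proof (induction n)
  case (Suc n)
  then obtain s where s: "\<forall>t\<ge>s. \<forall>y<n. Wst e t y \<longleftrightarrow> y \<in> W e" by blast
  have "\<exists>s'. \<forall>t\<ge>s'. Wst e t n \<longleftrightarrow> n \<in> W e"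
  proof (cases "n \<in> W e")
    case True
    then obtain s' where "Wst e s' n" unfolding W_iff_Wst ..
    then have "\<forall>t\<ge>s'. Wst e t n" using Wst_mono by blast
    then show ?thesis using True by blast
  next
    case False
    then show ?thesis unfolding W_iff_Wst by simp
  qed
  then obtain s' where s': "\<forall>t\<ge>s'. Wst e t n \<longleftrightarrow> n \<in> W e" ..
  have "\<forall>t\<ge>max s s'. \<forall>y<Suc n. Wst e t y \<longleftrightarrow> y \<in> W e"
    using s s' by (auto simp: less_Suc_eq)
  then show ?case by blast
qed simp

text \<open>Stagewise counts may rise and fall, but only the finitely many numbers below
  \<open>n\<close> matter, and these settle.\<close>

lemma diff_count_at_settles: "\<exists>s. \<forall>t\<ge>s. diff_count_at t a b n = diff_count a b n"
proof -
  obtain s where s: "\<forall>t\<ge>s. \<forall>y<n. Wst a t y \<longleftrightarrow> y \<in> W a" using Wst_settles ..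
  obtain s' where s': "\<forall>t\<ge>s'. \<forall>y<n. Wst b t y \<longleftrightarrow> y \<in> W b" using Wst_settles ..
  have "diff_count_at t a b n = diff_count a b n" if "t \<ge> max s s'" for t
    unfolding diff_count_at_def diff_count_def
    by (rule arg_cong[where f = card]) (use s s' that in \<open>auto simp: symdiff_def\<close>)
  then show ?thesis by blast
qed

section \<open>The closeness graph at scale \<open>k\<close>\<close>

definition close :: "nat \<Rightarrow> nat \<Rightarrow> nat \<Rightarrow> nat \<Rightarrow> bool" where
  "close k a b N \<longleftrightarrow> (\<forall>n\<ge>N. 2 ^ (k + a + b + 2) * diff_count a b n \<le> n)"

text \<open>
  Here \<open>w\<close> codes a triple \<open>(a, b, N)\<close>.  Requiring \<open>m \<le> t\<close> keeps a single early stage from witnessing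
  agreement up to every \<open>m\<close>.
\<close>

definition close_at :: "nat \<Rightarrow> nat \<Rightarrow> nat \<Rightarrow> nat \<Rightarrow> bool" where
  "close_at t k w m \<longleftrightarrow> m \<le> t \<and> (\<forall>n<m. p2 (p2 w) \<le> n \<longrightarrow>
     2 ^ (k + p1 w + p1 (p2 w) + 2) * diff_count_at t (p1 w) (p1 (p2 w)) n \<le> n)"

definition agree :: "nat \<Rightarrow> nat \<Rightarrow> nat \<Rightarrow> bool" where
  "agree k w m \<longleftrightarrow> (\<exists>t. close_at t k w m)"

lemma agree_antimono: "m \<le> m' \<Longrightarrow> agree k w m' \<Longrightarrow> agree k w m"
  unfolding agree_def close_at_def by (meson le_trans order_less_le_trans)

lemma agree_0: "agree k w 0"
  by (auto simp: agree_def close_at_def)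

text \<open>A late stage at which all counts below \<open>m\<close> are final witnesses
  \<open>agree\<close>; conversely, agreement at large \<open>m\<close> forces late stages.\<close>

lemma close_iff_agree: "close k (p1 w) (p1 (p2 w)) (p2 (p2 w)) \<longleftrightarrow> (\<forall>m. agree k w m)"
proof -
  define a b N where "a = p1 w" "b = p1 (p2 w)" "N = p2 (p2 w)"
  note ab = this
  show ?thesis
    unfolding ab[symmetric]
  proof
    assume c: "close k a b N"
    show "\<forall>m. agree k w m"
    proof
      fix m
      have "\<exists>s. \<forall>t\<ge>s. \<forall>n<m. diff_count_at t a b n = diff_count a b n"
      proof (induction m)
        case (Suc m)
        then obtain s where s: "\<forall>t\<ge>s. \<forall>n<m. diff_count_at t a b n = diff_count a b n" by blast
        obtain s' where s': "\<forall>t\<ge>s'. diff_count_at t a b m = diff_count a b m"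
          using diff_count_at_settles by blast
        have "\<forall>t\<ge>max s s'. \<forall>n<Suc m. diff_count_at t a b n = diff_count a b n"
          using s s' by (auto simp: less_Suc_eq)
        then show ?case by blast
      qed simp
      then obtain s where "\<forall>t\<ge>s. \<forall>n<m. diff_count_at t a b n = diff_count a b n" by blast
      then have "close_at (max s m) k w m" using c by (auto simp: close_at_def close_def ab)
      then show "agree k w m" by (auto simp: agree_def)
    qed
  next
    assume q: "\<forall>m. agree k w m"
    show "close k a b N"
      unfolding close_def
    proof (intro allI impI)
      fix n assume n: "N \<le> n"
      obtain s where s: "\<forall>t\<ge>s. diff_count_at t a b n = diff_count a b n"
        using diff_count_at_settles by blast
      \<comment> \<open>Since \<open>close_at\<close> bounds its last argument by \<open>t\<close>,
        this choice makes the count at \<open>n\<close> both final and checked.\<close>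
      obtain t where t: "close_at t k w (max s (Suc n))" using q by (auto simp: agree_def)
      then have "diff_count_at t a b n = diff_count a b n" using s by (auto simp: close_at_def)
      moreover have "n < max s (Suc n)" by simp
      ultimately show "2 ^ (k + a + b + 2) * diff_count a b n \<le> n"
        using t n unfolding close_at_def ab by metis
    qed
  qed
qed

lemma close_commute: "close k a b N \<Longrightarrow> close k b a N"
  unfolding close_def by (simp add: diff_count_commute[of a b] add.commute add.left_commute)

text \<open>Each edge is charged to its left endpoint, and the triangle inequality adds the
  charges.\<close>

lemma close_path:
  assumes "rtrancl_path (\<lambda>a b. \<exists>N. close k a b N) x xs y"
  shows "\<exists>N. \<forall>n\<ge>N. real (diff_count x y n) \<le> real n * (\<Sum>p\<leftarrow>x # xs. 1 / 2 ^ (k + p + 2))"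
  using assms
proof induction
  case (base x)
  show ?case by (simp add: diff_count_def symdiff_def)
next
  case (step x y ys z)
  obtain N where N: "\<forall>n\<ge>N. real (diff_count y z n) \<le> real n * (\<Sum>p\<leftarrow>y # ys. 1 / 2 ^ (k + p + 2))"
    using step.IH by blast
  obtain M where M: "close k x y M" using step.hyps(1) by blast
  have "real (diff_count x z n) \<le> real n * (\<Sum>p\<leftarrow>x # y # ys. 1 / 2 ^ (k + p + 2))"
    if n: "n \<ge> max M N" for n
  proof -
    have "2 ^ (k + x + 2) * diff_count x y n \<le> 2 ^ (k + x + y + 2) * diff_count x y n"
      by (intro mult_le_mono1 power_increasing) auto
    also have "\<dots> \<le> n" using M n unfolding close_def by simp
    finally have "real (2 ^ (k + x + 2) * diff_count x y n) \<le> real n" by (simp only: of_nat_le_iff)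
    then have "real (diff_count x y n) \<le> real n * (1 / 2 ^ (k + x + 2))"
      by (simp add: field_simps)
    moreover have "real (diff_count x z n) \<le> real (diff_count x y n) + real (diff_count y z n)"
      using diff_count_triangle[of x z n y] by linarith
    moreover have "real (diff_count y z n) \<le> real n * (\<Sum>p\<leftarrow>y # ys. 1 / 2 ^ (k + p + 2))"
      using N n by simp
    ultimately show ?thesis by (simp add: distrib_left)
  qed
  then show ?case by blast
qed

text \<open>Removing repetitions from a path makes the charged vertices distinct, so their weights
  form part of a geometric series.\<close>

lemma close_connected:
  assumes "(\<lambda>a b. \<exists>N. close k a b N)\<^sup>*\<^sup>* x y"
  shows "\<exists>N. \<forall>n\<ge>N. 2 ^ k * diff_count x y n \<le> n"
proof -
  obtain xs where "rtrancl_path (\<lambda>a b. \<exists>N. close k a b N) x xs y"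
    using assms unfolding rtranclp_eq_rtrancl_path by blast
  then obtain xs where p: "rtrancl_path (\<lambda>a b. \<exists>N. close k a b N) x xs y" and d: "distinct (x # xs)"
    by (rule rtrancl_path_distinct)
  obtain N where N: "\<forall>n\<ge>N. real (diff_count x y n) \<le> real n * (\<Sum>p\<leftarrow>x # xs. 1 / 2 ^ (k + p + 2))"
    using close_path[OF p] by blast
  have "(\<Sum>p\<leftarrow>x # xs. 1 / 2 ^ (k + p + 2) :: real) \<le> 1 / 2 ^ k"
  proof -
    obtain M where M: "set (x # xs) \<subseteq> {..<M}"
      using finite_set[of "x # xs"] unfolding finite_nat_set_iff_bounded by auto
    have "(\<Sum>p\<leftarrow>x # xs. 1 / 2 ^ (k + p + 2) :: real) = (\<Sum>p\<in>set (x # xs). 1 / 2 ^ (k + p + 2))"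
      by (rule sum_list_distinct_conv_sum_set[OF d])
    also have "\<dots> \<le> (\<Sum>p<M. 1 / 2 ^ (k + p + 2))"
      by (rule sum_mono2[OF _ M]) auto
    \<comment> \<open>The subtracted term carries the induction on \<open>M\<close>.\<close>
    also have "\<dots> \<le> 1 / 2 ^ k - 1 / 2 ^ (k + M)"
    proof (induction M)
      case (Suc M)
      have "1 / 2 ^ (k + M + 2) = 1 / 2 ^ (k + M) / (4::real)"
        "1 / 2 ^ (k + Suc M) = 1 / 2 ^ (k + M) / (2::real)" by simp_all
      moreover have "1 / 2 ^ (k + M) \<ge> (0::real)" by simp
      moreover have "S + u \<le> c - v" if "u = t / 4" "v = t / 2" "0 \<le> t" "S \<le> c - t" for S c t u v :: real
        using that by linarith
      ultimately show ?case using Suc unfolding sum.lessThan_Suc by blast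
    qed simp
    also have "\<dots> \<le> 1 / 2 ^ k" by simp
    finally show ?thesis .
  qed
  then have "2 ^ k * diff_count x y n \<le> n" if "n \<ge> N" for n
  proof -
    assume s: "(\<Sum>p\<leftarrow>x # xs. 1 / 2 ^ (k + p + 2) :: real) \<le> 1 / 2 ^ k"
    have "real (diff_count x y n) \<le> real n * (\<Sum>p\<leftarrow>x # xs. 1 / 2 ^ (k + p + 2))" using N that by blast
    also have "\<dots> \<le> real n * (1 / 2 ^ k)" by (intro mult_left_mono s) auto
    finally have "real (2 ^ k * diff_count x y n) \<le> real n" by (simp add: field_simps)
    then show ?thesis by (simp only: of_nat_le_iff)
  qed
  then show ?thesis by blast
qed

text \<open>
  The entry \<open>es ! w\<close> carries the membership of vertex \<open>w\<close> in the vertex set in its parity, and in its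
  half the guess about edge \<open>w\<close>: 0 stands for infinity and \<open>n + 1\<close> for the exact value \<open>n\<close>.
\<close>

definition active :: "nat \<Rightarrow> nat list \<Rightarrow> bool" where
  "active k es \<longleftrightarrow> (\<forall>w<length es.
     (es ! w div 2 = 0 \<longrightarrow> (odd (arg es (p1 w)) \<longleftrightarrow> odd (arg es (p1 (p2 w))))) \<and>
     (es ! w div 2 \<noteq> 0 \<longrightarrow> agree k w (es ! w div 2 - 1)))"

definition refuted :: "nat \<Rightarrow> nat list \<Rightarrow> bool" where
  "refuted k es \<longleftrightarrow> (\<exists>w<length es. es ! w div 2 \<noteq> 0 \<and> agree k w (es ! w div 2))"

definition guess_set :: "nat \<Rightarrow> nat \<Rightarrow> nat set" where
  "guess_set k u = list_encode ` {es. active k es \<and> (odd (arg es u) \<or> refuted k es)}"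

lemma list_encode_guess_set:
  "list_encode es \<in> guess_set k u \<longleftrightarrow> active k es \<and> (odd (arg es u) \<or> refuted k es)"
  by (auto simp: guess_set_def list_encode_eq)

text \<open>A list telling \<open>i\<close> and \<open>j\<close> apart is not refuted, so its finite
  guesses are exact. If it reached past the true edge \<open>?w\<close>, it would have to guess
  infinity there and treat \<open>i\<close> and \<open>j\<close> alike. Hence its length is
  bounded.\<close>

lemma guess_set_finite_diff:
  assumes "close k i j N" shows "finite (symdiff (guess_set k i) (guess_set k j))"
proof -
  let ?w = "pr i (pr j N)"
  have all: "agree k ?w m" for m using close_iff_agree[of k ?w] assms by simp
  \<comment> \<open>The entries possible at \<open>w\<close> in an active list that is not refuted:
    infinity or the exact length, with either parity.\<close>
  define F where "F w = {e. e div 2 = 0 \<or> agree k w (e div 2 - 1) \<and> \<not> agree k w (e div 2)}" for w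
  have fin: "finite (F w)" for w
  proof (cases "\<forall>m. agree k w m")
    case True
    then have "F w \<subseteq> {..1}" by (auto simp: F_def)
    then show ?thesis by (rule finite_subset) simp
  next
    case False
    then obtain M where M: "\<not> agree k w M" by blast
    have "e \<le> 2 * M + 1" if "e \<in> F w" for e
    proof (rule ccontr)
      assume "\<not> ?thesis"
      then have "M \<le> e div 2 - 1" "e div 2 \<noteq> 0" by linarith+
      then show False using that M agree_antimono[of M "e div 2 - 1"] by (auto simp: F_def)
    qed
    then have "F w \<subseteq> {..2 * M + 1}" by blast
    then show ?thesis by (rule finite_subset) simp
  qed
  have "symdiff (guess_set k i) (guess_set k j) \<subseteq>
      list_encode ` {es. set es \<subseteq> (\<Union>w<?w. F w) \<and> length es \<le> ?w}"
  proof
    fix y assume y: "y \<in> symdiff (guess_set k i) (guess_set k j)"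
    obtain es where es: "y = list_encode es" by (metis list_decode_inverse)
    have act: "active k es" and nr: "\<not> refuted k es" and od: "odd (arg es i) \<noteq> odd (arg es j)"
      using y unfolding es symdiff_def by (auto simp: list_encode_guess_set)
    have len: "length es \<le> ?w"
    proof (rule ccontr)
      assume "\<not> ?thesis"
      then have w: "?w < length es" by simp
      show False
      proof (cases "es ! ?w div 2 = 0")
        case True
        then show False using act w od unfolding active_def
          by (metis fst_conv prod_encode_inverse snd_conv)
      next
        case False
        then show False using nr w all by (auto simp: refuted_def)
      qed
    qed
    moreover have "set es \<subseteq> (\<Union>w<?w. F w)"
    proof
      fix e assume "e \<in> set es"
      then obtain w where w: "w < length es" "e = es ! w" by (metis in_set_conv_nth)
      then have "e \<in> F w" using act nr unfolding active_def refuted_def F_def by blast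
      then show "e \<in> (\<Union>w<?w. F w)" using w len by force
    qed
    ultimately show "y \<in> list_encode ` {es. set es \<subseteq> (\<Union>w<?w. F w) \<and> length es \<le> ?w}"
      using es by blast
  qed
  then show ?thesis
    by (rule finite_subset) (intro finite_imageI finite_lists_length_le finite_UN_I fin, simp)
qed

text \<open>The sequence of correct guesses, with the component of \<open>i\<close> as vertex set,
  has infinitely many prefixes, and every sufficiently long one separates \<open>i\<close> from
  \<open>j\<close>.\<close>

lemma guess_set_infinite_diff:
  assumes nc: "\<not> (\<lambda>a b. \<exists>N. close k a b N)\<^sup>*\<^sup>* i j"
  shows "infinite (symdiff (guess_set k i) (guess_set k j))"
proof -
  let ?E = "\<lambda>a b. \<exists>N. close k a b N"
  have "\<exists>c. (c = 0 \<and> (\<forall>m. agree k w m)) \<or> (c \<noteq> 0 \<and> agree k w (c - 1) \<and> \<not> agree k w c)" for w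
  proof (cases "\<forall>m. agree k w m")
    case False
    \<comment> \<open>The least failure is positive by \<open>agree_0\<close>, and as a guess it
      stands for the exact length \<open>c - 1\<close>.\<close>
    define c where "c = (LEAST m. \<not> agree k w m)"
    have c: "\<not> agree k w c" using False unfolding c_def by (metis LeastI)
    then have "c \<noteq> 0" using agree_0 by metis
    then have "agree k w (c - 1)" using not_less_Least[of "c - 1" "\<lambda>m. \<not> agree k w m"] unfolding c_def by auto
    then show ?thesis using c \<open>c \<noteq> 0\<close> by blast
  qed auto
  then obtain c where c: "\<And>w. (c w = 0 \<and> (\<forall>m. agree k w m)) \<or>
      (c w \<noteq> 0 \<and> agree k w (c w - 1) \<and> \<not> agree k w (c w))" by metis
  define es where "es l = map (\<lambda>w. 2 * c w + of_bool (?E\<^sup>*\<^sup>* i w)) [0..<l]" for l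
  have len: "length (es l) = l" for l by (simp add: es_def)
  have div: "es l ! w div 2 = c w" if "w < l" for l w using that by (simp add: es_def)
  have odd: "odd (arg (es l) u) \<longleftrightarrow> ?E\<^sup>*\<^sup>* i u" if "u < l" for l u
    using that by (simp add: es_def arg_def)
  have act: "active k (es l)" for l
    unfolding active_def len
  proof (intro allI impI conjI)
    fix w assume w: "w < l"
    show "agree k w (es l ! w div 2 - 1)" if "es l ! w div 2 \<noteq> 0"
      using that c[of w] w by (auto simp: div)
    assume "es l ! w div 2 = 0"
    then have "\<forall>m. agree k w m" using c[of w] w by (auto simp: div)
    then have cl: "close k (p1 w) (p1 (p2 w)) (p2 (p2 w))" by (simp add: close_iff_agree)
    then have "?E\<^sup>*\<^sup>* i (p1 w) \<longleftrightarrow> ?E\<^sup>*\<^sup>* i (p1 (p2 w))"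
      using close_commute[OF cl] by (metis (mono_tags, lifting) rtranclp.rtrancl_into_rtrancl)
    \<comment> \<open>Both endpoints are at most \<open>w < l\<close>, so \<open>arg\<close> reads
      actual entries and not the default 0.\<close>
    moreover have "p1 w \<le> w" by (metis le_prod_encode_1 prod.collapse prod_decode_inverse)
    moreover have "p1 (p2 w) \<le> w"
      by (metis le_prod_encode_1 le_prod_encode_2 order_trans prod.collapse prod_decode_inverse)
    ultimately show "odd (arg (es l) (p1 w)) \<longleftrightarrow> odd (arg (es l) (p1 (p2 w)))"
      using w odd by auto
  qed
  have nr: "\<not> refuted k (es l)" for l
    using c unfolding refuted_def len by (metis div)
  have "list_encode (es l) \<in> symdiff (guess_set k i) (guess_set k j)" if "l > max i j" for l
    using that act nr odd nc by (auto simp: symdiff_def list_encode_guess_set)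
  then have "(\<lambda>l. list_encode (es l)) ` {max i j<..} \<subseteq> symdiff (guess_set k i) (guess_set k j)" by blast
  moreover have "inj_on (\<lambda>l. list_encode (es l)) {max i j<..}"
    by (rule inj_onI) (metis len list_encode_eq)
  then have "infinite ((\<lambda>l. list_encode (es l)) ` {max i j<..})"
    using finite_imageD infinite_Ioi by blast
  ultimately show ?thesis using finite_subset by blast
qed

text \<open>Density zero gives a direct edge at every scale; conversely, being connected at scale
  \<open>k\<close> bounds the density by \<open>1 / 2 ^ k\<close>.\<close>

lemma Z0ce_iff_guess_set: "Z0ce i j \<longleftrightarrow> (\<forall>k. finite (symdiff (guess_set k i) (guess_set k j)))"
proof
  assume z: "Z0ce i j"
  show "\<forall>k. finite (symdiff (guess_set k i) (guess_set k j))"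
  proof
    fix k
    obtain N where "close k i j N" using z unfolding Z0ce_iff close_def diff_count_def by blast
    then show "finite (symdiff (guess_set k i) (guess_set k j))" by (rule guess_set_finite_diff)
  qed
next
  assume "\<forall>k. finite (symdiff (guess_set k i) (guess_set k j))"
  then have "(\<lambda>a b. \<exists>N. close k a b N)\<^sup>*\<^sup>* i j" for k using guess_set_infinite_diff by blast
  from close_connected[OF this] show "Z0ce i j" unfolding Z0ce_iff diff_count_def by blast
qed

section \<open>Decidable approximations to the guess sets\<close>

definition agree_by :: "nat \<Rightarrow> nat \<Rightarrow> nat \<Rightarrow> nat \<Rightarrow> bool" where
  "agree_by s k w m \<longleftrightarrow> (\<exists>t<s. close_at t k w m)"

text \<open>Works on the list code: \<open>dropc w y \<noteq> 0\<close> says that \<open>w\<close>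
  is below the length, and the bound \<open>y\<close> suffices because a list is no longer than its
  code.\<close>

definition guess_at :: "nat \<Rightarrow> nat \<Rightarrow> nat \<Rightarrow> nat \<Rightarrow> bool" where
  "guess_at s k u y \<longleftrightarrow>
    (\<forall>w<y. dropc w y \<noteq> 0 \<longrightarrow>
      (hdc (dropc w y) div 2 = 0 \<longrightarrow>
        (odd (hdc (dropc (p1 w) y)) \<longleftrightarrow> odd (hdc (dropc (p1 (p2 w)) y)))) \<and>
      (hdc (dropc w y) div 2 \<noteq> 0 \<longrightarrow> agree_by s k w (hdc (dropc w y) div 2 - 1))) \<and>
    (odd (hdc (dropc u y)) \<or>
     (\<exists>w<y. dropc w y \<noteq> 0 \<and> hdc (dropc w y) div 2 \<noteq> 0 \<and> agree_by s k w (hdc (dropc w y) div 2)))"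

lemma agree_by_mono: "s \<le> s' \<Longrightarrow> agree_by s k w m \<Longrightarrow> agree_by s' k w m"
  unfolding agree_by_def by (meson order_less_le_trans)

lemma agree_iff_agree_by: "agree k w m \<longleftrightarrow> (\<exists>s. agree_by s k w m)"
  unfolding agree_by_def agree_def by (meson lessI)

lemma length_le_list_encode: "length xs \<le> list_encode xs"
proof (induction xs)
  case (Cons x xs)
  then show ?case using le_prod_encode_2[of "list_encode xs" x] by simp
qed simp

lemma guess_at_list_encode:
  "guess_at s k u (list_encode es) \<longleftrightarrow>
    (\<forall>w<length es.
      (es ! w div 2 = 0 \<longrightarrow> (odd (arg es (p1 w)) \<longleftrightarrow> odd (arg es (p1 (p2 w))))) \<and>
      (es ! w div 2 \<noteq> 0 \<longrightarrow> agree_by s k w (es ! w div 2 - 1))) \<and>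
    (odd (arg es u) \<or> (\<exists>w<length es. es ! w div 2 \<noteq> 0 \<and> agree_by s k w (es ! w div 2)))"
proof -
  have all: "(\<forall>w<list_encode es. \<not> length es \<le> w \<longrightarrow> P w (arg es w)) \<longleftrightarrow> (\<forall>w<length es. P w (es ! w))"
    and ex: "(\<exists>w<list_encode es. \<not> length es \<le> w \<and> P w (arg es w)) \<longleftrightarrow> (\<exists>w<length es. P w (es ! w))"
    for P
    using length_le_list_encode[of es] by (auto simp: arg_def not_le dest: order_less_le_trans)
  show ?thesis
    unfolding guess_at_def hdc_dropc dropc_eq_0_iff
      all[of "\<lambda>w e. (e div 2 = 0 \<longrightarrow> (odd (arg es (p1 w)) \<longleftrightarrow> odd (arg es (p1 (p2 w))))) \<and>
        (e div 2 \<noteq> 0 \<longrightarrow> agree_by s k w (e div 2 - 1))"]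
      ex[of "\<lambda>w e. e div 2 \<noteq> 0 \<and> agree_by s k w (e div 2)"] ..
qed

lemma bounded_collect:
  assumes "\<forall>w<l. \<exists>s. P s w" "\<And>s s' w. s \<le> s' \<Longrightarrow> P s w \<Longrightarrow> P s' w"
  shows "\<exists>s::nat. \<forall>w<l::nat. P s w"
  using assms(1)
proof (induction l)
  case (Suc l)
  then obtain s s' where "\<forall>w<l. P s w" "P s' l" by (meson less_Suc_eq)
  then have "\<forall>w<Suc l. P (max s s') w" using assms(2) by (metis less_Suc_eq max.cobounded1 max.cobounded2)
  then show ?case ..
qed simp

text \<open>\<open>agree_by\<close> is monotone in \<open>s\<close>, unlike \<open>close_at\<close>
  in its stage, so the finitely many witnesses for one list merge into a single bound.\<close>

lemma guess_set_iff: "y \<in> guess_set k u \<longleftrightarrow> (\<exists>s. guess_at s k u y)"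
proof -
  obtain es where y: "y = list_encode es" by (metis list_decode_inverse)
  show ?thesis
    unfolding y list_encode_guess_set
  proof
    assume a: "active k es \<and> (odd (arg es u) \<or> refuted k es)"
    let ?P = "\<lambda>s w. (es ! w div 2 = 0 \<longrightarrow> (odd (arg es (p1 w)) \<longleftrightarrow> odd (arg es (p1 (p2 w))))) \<and>
      (es ! w div 2 \<noteq> 0 \<longrightarrow> agree_by s k w (es ! w div 2 - 1))"
    have P: "s \<le> s' \<Longrightarrow> ?P s w \<Longrightarrow> ?P s' w" for s s' w
      using agree_by_mono by blast
    have "\<forall>w<length es. \<exists>s. ?P s w" using a unfolding active_def agree_iff_agree_by by blast
    then have "\<exists>s. \<forall>w<length es. ?P s w" by (rule bounded_collect) (rule P)
    then obtain s where s: "\<forall>w<length es. ?P s w" ..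
    consider "odd (arg es u)" | w s' where "w < length es" "es ! w div 2 \<noteq> 0" "agree_by s' k w (es ! w div 2)"
      using a unfolding refuted_def agree_iff_agree_by by blast
    then show "\<exists>s. guess_at s k u (list_encode es)"
    proof cases
      case 1
      then show ?thesis using s unfolding guess_at_list_encode by blast
    next
      case 2
      have "\<forall>w<length es. ?P (max s s') w" using s P[OF max.cobounded1] by blast
      then show ?thesis using 2 agree_by_mono[OF max.cobounded2] unfolding guess_at_list_encode by blast
    qed
  next
    assume "\<exists>s. guess_at s k u (list_encode es)"
    then show "active k es \<and> (odd (arg es u) \<or> refuted k es)"
      unfolding guess_at_list_encode active_def refuted_def agree_iff_agree_by by blast
  qed
qed

lemma computable_diff_count_at [computable_intros]:
  assumes "computable T" "computable A" "computable B" "computable N"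
  shows "computable (\<lambda>x. diff_count_at (T x) (A x) (B x) (N x))"
  unfolding diff_count_at_def by (intro computable_intros assms assms[THEN computable_compose])

lemma dec_close_at [computable_intros]:
  assumes "computable T" "computable K" "computable V" "computable M"
  shows "dec (\<lambda>x. close_at (T x) (K x) (V x) (M x))"
  unfolding close_at_def by (intro computable_intros assms assms[THEN computable_compose])

lemma dec_agree_by [computable_intros]:
  assumes "computable S" "computable K" "computable V" "computable M"
  shows "dec (\<lambda>x. agree_by (S x) (K x) (V x) (M x))"
  unfolding agree_by_def by (intro computable_intros assms assms[THEN computable_compose])

lemma dec_guess_at [computable_intros]:
  assumes "computable S" "computable K" "computable U" "computable Y"
  shows "dec (\<lambda>x. guess_at (S x) (K x) (U x) (Y x))"
  unfolding guess_at_def by (intro computable_intros assms assms[THEN computable_compose])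

lemma Z0ce_reducible_E3ce: "creducible Z0ce E3ce"
proof -
  \<comment> \<open>Here \<open>z\<close> codes \<open>i\<close>, the element and the stage; the
    element is a pair of list code and column index \<open>k\<close>.\<close>
  have "dec (\<lambda>z. guess_at (p2 (p2 z)) (p2 (p1 (p2 z))) (p1 z) (p1 (p1 (p2 z))))"
    by (intro computable_intros)
  from smn_uniformly_ce[of "\<lambda>i x s. guess_at s (p2 x) i (p1 x)", OF this]
  obtain g where g: "computable g" "\<And>i. W (g i) = {x. \<exists>s. guess_at s (p2 x) i (p1 x)}"
    by auto
  have "column (W (g i)) k = guess_set k i" for i k
    unfolding g(2) column_def by (auto simp: guess_set_iff)
  then have "Z0ce i j \<longleftrightarrow> E3ce (g i) (g j)" for i j
    unfolding E3ce_def Z0ce_iff_guess_set by simp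
  then show ?thesis using g(1) unfolding creducible_def by blast
qed

theorem theorem2p5:
  shows "creducible E3ce Z0ce \<and> creducible Z0ce E3ce"
  using E3ce_reducible_Z0ce Z0ce_reducible_E3ce by blast

end
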